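(* Let $(M,\varphi,\xi,\eta,g,\varepsilon)$ be an $(\varepsilon)$-para Sasakian manifold, let $\mu$ be a real constant, and set $\alpha:=\frac12\mathcal{L}_\xi g+S+\mu\,\eta\otimes\eta$. Then $\alpha$ is parallel ($\nabla\alpha=0$) if and only if $(g,\xi,\lambda,\mu)$ with $\lambda=-\varepsilon\alpha(\xi,\xi)$ is an $\eta$-Ricci soliton on $M$.
   Context: An $(\varepsilon)$-almost paracontact metric structure $(\varphi,\xi,\eta,g,\varepsilon)$ on an $n$-dimensional manifold $M$ consists of a $(1,1)$-tensor field $\varphi$, a vector field $\xi$, a $1$-form $\eta$, a pseudo-Riemannian metric $g$ and $\varepsilon\in\{1,-1\}$ with $\varphi^2=I-\eta\otimes\xi$, $\eta(\xi)=1$, $\varphi\xi=0$, $\eta\circ\varphi=0$ and $g(\varphi X,\varphi Y)=g(X,Y)-\varepsilon\eta(X)\eta(Y)$ for all vector fields $X,Y$. (Consequently $g(X,\xi)=\varepsilon\eta(X)$ and $g(\varphi X,Y)=g(X,\varphi Y)$.) It is $(\varepsilon)$-para Sasakian if $(\nabla_X\varphi)Y=-g(\varphi X,\varphi Y)\xi-\varepsilon\eta(Y)\varphi^2X$ for all $X,Y$, where $\nabla$ is the Levi-Civita connection of $g$; in that case one has $\nabla_X\xi=\varepsilon\varphi X$ and $R(X,Y)\xi=\eta(X)Y-\eta(Y)X$. $S$ is the Ricci tensor, with conventions $R(X,Y)Z=\nabla_X\nabla_YZ-\nabla_Y\nabla_XZ-\nabla_{[X,Y]}Z$, $S(Y,Z)=\mathrm{trace}(X\mapsto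 R(X,Y)Z)$. $(g,\xi,\lambda,\mu)$ is an $\eta$-Ricci soliton if $\lambda,\mu$ are real constants and $\frac12\mathcal{L}_\xi g+S+\lambda g+\mu\,\eta\otimes\eta=0$. *)

theory Defs
  imports "HOL-Analysis.Analysis"
begin

section \<open>Smooth maps between Euclidean spaces\<close>

text \<open>
  A map on an open set is of class \<open>C\<^sup>k\<^sup>+\<^sup>1\<close> iff it is differentiable there and all its
  directional derivatives are of class \<open>C\<^sup>k\<close>; in finite dimension this is the usual notion.
  It is only used for open sets, so derivatives may be taken with the filter \<open>at x\<close>.
\<close>

primrec Ck_on :: "nat \<Rightarrow> 'b::euclidean_space set \<Rightarrow> ('b \<Rightarrow> 'c::real_normed_vector) \<Rightarrow> bool" where
  "Ck_on 0 S f \<longleftrightarrow> continuous_on S f"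
| "Ck_on (Suc k) S f \<longleftrightarrow>
     (\<forall>x\<in>S. f differentiable (at x)) \<and> (\<forall>v. Ck_on k S (\<lambda>x. frechet_derivative f (at x) v))"

definition smooth_on :: "'b::euclidean_space set \<Rightarrow> ('b \<Rightarrow> 'c::real_normed_vector) \<Rightarrow> bool" where
  "smooth_on S f \<longleftrightarrow> (\<forall>k. Ck_on k S f)"


section \<open>Smooth manifolds\<close>

text \<open>
  A chart is a pair \<open>(U, h)\<close> of its domain and its coordinate map. The values of \<open>h\<close> outside \<open>U\<close>
  are irrelevant. The dimension of the manifold is \<open>CARD('n)\<close>.
\<close>

type_synonym ('a, 'n) chart = "'a set \<times> ('a \<Rightarrow> real ^ 'n)"

abbreviation chart_inv :: "('a, 'n::finite) chart \<Rightarrow> real ^ 'n \<Rightarrow> 'a" where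
  "chart_inv c \<equiv> inv_into (fst c) (snd c)"

definition is_chart :: "'a topology \<Rightarrow> ('a, 'n::finite) chart \<Rightarrow> bool" where
  "is_chart M c \<longleftrightarrow>
     openin M (fst c) \<and> open (snd c ` fst c) \<and>
     homeomorphic_map (subtopology M (fst c)) (top_of_set (snd c ` fst c)) (snd c)"

text \<open>
  The atlas \<open>A\<close> is not required to be maximal; the notions of smoothness below only depend on the
  smooth structure generated by \<open>A\<close>.
\<close>

definition smooth_manifold :: "'a topology \<Rightarrow> ('a, 'n::finite) chart set \<Rightarrow> bool" where
  "smooth_manifold M A \<longleftrightarrow>
     Hausdorff_space M \<and> second_countable M \<and>
     (\<forall>c\<in>A. is_chart M c) \<and> (\<Union>c\<in>A. fst c) = topspace M \<and>
     (\<forall>c\<in>A. \<forall>d\<in>A. smooth_on (snd c ` (fst c \<inter> fst d)) (snd d \<circ> chart_inv c))"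

definition smooth_function :: "('a, 'n::finite) chart set \<Rightarrow> ('a \<Rightarrow> real) \<Rightarrow> bool" where
  "smooth_function A f \<longleftrightarrow> (\<forall>c\<in>A. smooth_on (snd c ` fst c) (f \<circ> chart_inv c))"


section \<open>Tangent vectors and tensor fields\<close>

text \<open>
  At every point \<open>p\<close> a preferred chart \<open>chart_at A p\<close> is fixed, and the tangent space at \<open>p\<close> is
  identified with \<^typ>\<open>real ^ 'n\<close> by means of the coordinates of that chart. Preferred charts
  at different points are unrelated, so the coordinates of a tangent vector in another chart
  \<open>c\<close> are obtained with the Jacobian of the change of coordinates (\<open>to_coords\<close>; its inverse
  is \<open>from_coords\<close>). Smoothness of fields is always expressed by components in actual charts.

  All fields are total functions on the type of points, but only their values on \<open>topspace M\<close>
  matter.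
\<close>

definition chart_at :: "('a, 'n::finite) chart set \<Rightarrow> 'a \<Rightarrow> ('a, 'n) chart" where
  "chart_at A p = (SOME c. c \<in> A \<and> p \<in> fst c)"

definition to_coords ::
  "('a, 'n::finite) chart set \<Rightarrow> ('a, 'n) chart \<Rightarrow> 'a \<Rightarrow> real ^ 'n \<Rightarrow> real ^ 'n" where
  "to_coords A c p =
     frechet_derivative (snd c \<circ> chart_inv (chart_at A p)) (at (snd (chart_at A p) p))"

definition from_coords ::
  "('a, 'n::finite) chart set \<Rightarrow> ('a, 'n) chart \<Rightarrow> 'a \<Rightarrow> real ^ 'n \<Rightarrow> real ^ 'n" where
  "from_coords A c p =
     frechet_derivative (snd (chart_at A p) \<circ> chart_inv c) (at (snd c p))"

text \<open>The derivative \<open>v f\<close> of a function \<open>f\<close> along a tangent vector \<open>v\<close> at \<open>p\<close>.\<close>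

definition dir_deriv ::
  "('a, 'n::finite) chart set \<Rightarrow> 'a \<Rightarrow> real ^ 'n \<Rightarrow> ('a \<Rightarrow> real) \<Rightarrow> real" where
  "dir_deriv A p v f =
     frechet_derivative (f \<circ> chart_inv (chart_at A p)) (at (snd (chart_at A p) p)) v"

definition smooth_vector_field ::
  "('a, 'n::finite) chart set \<Rightarrow> ('a \<Rightarrow> real ^ 'n) \<Rightarrow> bool" where
  "smooth_vector_field A X \<longleftrightarrow>
     (\<forall>c\<in>A. smooth_on (snd c ` fst c)
        (\<lambda>u. let p = chart_inv c u in to_coords A c p (X p)))"

definition one_form ::
  "'a topology \<Rightarrow> ('a, 'n::finite) chart set \<Rightarrow> ('a \<Rightarrow> real ^ 'n \<Rightarrow> real) \<Rightarrow> bool" where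
  "one_form M A \<eta> \<longleftrightarrow>
     (\<forall>p\<in>topspace M. linear (\<eta> p)) \<and>
     (\<forall>c\<in>A. \<forall>w. smooth_on (snd c ` fst c)
        (\<lambda>u. let p = chart_inv c u in \<eta> p (from_coords A c p w)))"

definition tensor_field_11 ::
  "'a topology \<Rightarrow> ('a, 'n::finite) chart set \<Rightarrow> ('a \<Rightarrow> real ^ 'n \<Rightarrow> real ^ 'n) \<Rightarrow> bool" where
  "tensor_field_11 M A \<phi> \<longleftrightarrow>
     (\<forall>p\<in>topspace M. linear (\<phi> p)) \<and>
     (\<forall>c\<in>A. \<forall>w. smooth_on (snd c ` fst c)
        (\<lambda>u. let p = chart_inv c u in to_coords A c p (\<phi> p (from_coords A c p w))))"

definition tensor_field_02 ::
  "'a topology \<Rightarrow> ('a, 'n::finite) chart set \<Rightarrow> ('a \<Rightarrow> real ^ 'n \<Rightarrow> real ^ 'n \<Rightarrow> real) \<Rightarrow> bool" where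
  "tensor_field_02 M A g \<longleftrightarrow>
     (\<forall>p\<in>topspace M. bilinear (g p)) \<and>
     (\<forall>c\<in>A. \<forall>v w. smooth_on (snd c ` fst c)
        (\<lambda>u. let p = chart_inv c u in g p (from_coords A c p v) (from_coords A c p w)))"

text \<open>
  The index of a symmetric bilinear form: the largest dimension of a subspace on which it is
  negative definite. A pseudo-Riemannian metric has the same index at all points.
\<close>

definition bilinear_index :: "(real ^ 'n \<Rightarrow> real ^ 'n \<Rightarrow> real) \<Rightarrow> nat" where
  "bilinear_index b = Max {dim W | W. subspace W \<and> (\<forall>w\<in>W. w \<noteq> 0 \<longrightarrow> b w w < 0)}"

definition pseudo_riemannian_metric ::
  "'a topology \<Rightarrow> ('a, 'n::finite) chart set \<Rightarrow> ('a \<Rightarrow> real ^ 'n \<Rightarrow> real ^ 'n \<Rightarrow> real) \<Rightarrow> bool" where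
  "pseudo_riemannian_metric M A g \<longleftrightarrow>
     tensor_field_02 M A g \<and>
     (\<forall>p\<in>topspace M. \<forall>v w. g p v w = g p w v) \<and>
     (\<forall>p\<in>topspace M. \<forall>v. (\<forall>w. g p v w = 0) \<longrightarrow> v = 0) \<and>
     (\<exists>\<nu>. \<forall>p\<in>topspace M. bilinear_index (g p) = \<nu>)"


section \<open>Lie bracket, Levi-Civita connection and curvature\<close>

text \<open>\<open>[X, Y]\<close> is the vector field with \<open>[X, Y] f = X (Y f) - Y (X f)\<close> for all smooth \<open>f\<close>.\<close>

definition lie_bracket ::
  "('a, 'n::finite) chart set \<Rightarrow> ('a \<Rightarrow> real ^ 'n) \<Rightarrow> ('a \<Rightarrow> real ^ 'n) \<Rightarrow> 'a \<Rightarrow> real ^ 'n" where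
  "lie_bracket A X Y = (\<lambda>p. THE v. \<forall>f. smooth_function A f \<longrightarrow>
     dir_deriv A p v f =
       dir_deriv A p (X p) (\<lambda>q. dir_deriv A q (Y q) f) -
       dir_deriv A p (Y p) (\<lambda>q. dir_deriv A q (X q) f))"

text \<open>\<open>D X Y\<close> stands for the covariant derivative of \<open>Y\<close> in the direction of \<open>X\<close>.\<close>

definition affine_connection ::
  "'a topology \<Rightarrow> ('a, 'n::finite) chart set \<Rightarrow>
     (('a \<Rightarrow> real ^ 'n) \<Rightarrow> ('a \<Rightarrow> real ^ 'n) \<Rightarrow> 'a \<Rightarrow> real ^ 'n) \<Rightarrow> bool" where
  "affine_connection M A D \<longleftrightarrow>
     (\<forall>X Y. smooth_vector_field A X \<longrightarrow> smooth_vector_field A Y \<longrightarrow>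
        smooth_vector_field A (D X Y)) \<and>
     (\<forall>X X' Y. smooth_vector_field A X \<longrightarrow> smooth_vector_field A X' \<longrightarrow>
        smooth_vector_field A Y \<longrightarrow>
        (\<forall>p\<in>topspace M. D (\<lambda>q. X q + X' q) Y p = D X Y p + D X' Y p)) \<and>
     (\<forall>f X Y. smooth_function A f \<longrightarrow> smooth_vector_field A X \<longrightarrow> smooth_vector_field A Y \<longrightarrow>
        (\<forall>p\<in>topspace M. D (\<lambda>q. f q *\<^sub>R X q) Y p = f p *\<^sub>R D X Y p)) \<and>
     (\<forall>X Y Y'. smooth_vector_field A X \<longrightarrow> smooth_vector_field A Y \<longrightarrow>
        smooth_vector_field A Y' \<longrightarrow>
        (\<forall>p\<in>topspace M. D X (\<lambda>q. Y q + Y' q) p = D X Y p + D X Y' p)) \<and>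
     (\<forall>f X Y. smooth_function A f \<longrightarrow> smooth_vector_field A X \<longrightarrow> smooth_vector_field A Y \<longrightarrow>
        (\<forall>p\<in>topspace M.
           D X (\<lambda>q. f q *\<^sub>R Y q) p = dir_deriv A p (X p) f *\<^sub>R Y p + f p *\<^sub>R D X Y p))"

definition levi_civita_connection ::
  "'a topology \<Rightarrow> ('a, 'n::finite) chart set \<Rightarrow> ('a \<Rightarrow> real ^ 'n \<Rightarrow> real ^ 'n \<Rightarrow> real) \<Rightarrow>
     (('a \<Rightarrow> real ^ 'n) \<Rightarrow> ('a \<Rightarrow> real ^ 'n) \<Rightarrow> 'a \<Rightarrow> real ^ 'n) \<Rightarrow> bool" where
  "levi_civita_connection M A g D \<longleftrightarrow>
     affine_connection M A D \<and>
     (\<forall>X Y. smooth_vector_field A X \<longrightarrow> smooth_vector_field A Y \<longrightarrow>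
        (\<forall>p\<in>topspace M. D X Y p - D Y X p = lie_bracket A X Y p)) \<and>
     (\<forall>X Y Z. smooth_vector_field A X \<longrightarrow> smooth_vector_field A Y \<longrightarrow> smooth_vector_field A Z \<longrightarrow>
        (\<forall>p\<in>topspace M.
           dir_deriv A p (X p) (\<lambda>q. g q (Y q) (Z q)) =
             g p (D X Y p) (Z p) + g p (Y p) (D X Z p)))"

definition curvature ::
  "('a, 'n::finite) chart set \<Rightarrow>
     (('a \<Rightarrow> real ^ 'n) \<Rightarrow> ('a \<Rightarrow> real ^ 'n) \<Rightarrow> 'a \<Rightarrow> real ^ 'n) \<Rightarrow>
     ('a \<Rightarrow> real ^ 'n) \<Rightarrow> ('a \<Rightarrow> real ^ 'n) \<Rightarrow> ('a \<Rightarrow> real ^ 'n) \<Rightarrow> 'a \<Rightarrow> real ^ 'n" where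
  "curvature A D X Y Z =
     (\<lambda>p. D X (D Y Z) p - D Y (D X Z) p - D (lie_bracket A X Y) Z p)"

text \<open>
  The value of \<open>R(X, Y) Z\<close> at \<open>p\<close> depends on \<open>X\<close> only through its value at \<open>p\<close>. Hence
  \<open>X \<mapsto> R(X, Y) Z\<close> induces an endomorphism of the tangent space at \<open>p\<close>, obtained by extending
  tangent vectors to smooth vector fields in an arbitrary way, and the Ricci tensor is its trace.
\<close>

definition extend_vector ::
  "('a, 'n::finite) chart set \<Rightarrow> 'a \<Rightarrow> real ^ 'n \<Rightarrow> 'a \<Rightarrow> real ^ 'n" where
  "extend_vector A p v = (SOME X. smooth_vector_field A X \<and> X p = v)"

definition ricci ::
  "('a, 'n::finite) chart set \<Rightarrow>
     (('a \<Rightarrow> real ^ 'n) \<Rightarrow> ('a \<Rightarrow> real ^ 'n) \<Rightarrow> 'a \<Rightarrow> real ^ 'n) \<Rightarrow>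
     ('a \<Rightarrow> real ^ 'n) \<Rightarrow> ('a \<Rightarrow> real ^ 'n) \<Rightarrow> 'a \<Rightarrow> real" where
  "ricci A D Y Z = (\<lambda>p. trace (matrix (\<lambda>v. curvature A D (extend_vector A p v) Y Z p)))"

definition lie_derivative_metric ::
  "('a, 'n::finite) chart set \<Rightarrow> ('a \<Rightarrow> real ^ 'n) \<Rightarrow> ('a \<Rightarrow> real ^ 'n \<Rightarrow> real ^ 'n \<Rightarrow> real) \<Rightarrow>
     ('a \<Rightarrow> real ^ 'n) \<Rightarrow> ('a \<Rightarrow> real ^ 'n) \<Rightarrow> 'a \<Rightarrow> real" where
  "lie_derivative_metric A V g X Y =
     (\<lambda>p. dir_deriv A p (V p) (\<lambda>q. g q (X q) (Y q)) -
          g p (lie_bracket A V X p) (Y p) - g p (X p) (lie_bracket A V Y p))"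

definition parallel_02 ::
  "'a topology \<Rightarrow> ('a, 'n::finite) chart set \<Rightarrow>
     (('a \<Rightarrow> real ^ 'n) \<Rightarrow> ('a \<Rightarrow> real ^ 'n) \<Rightarrow> 'a \<Rightarrow> real ^ 'n) \<Rightarrow>
     (('a \<Rightarrow> real ^ 'n) \<Rightarrow> ('a \<Rightarrow> real ^ 'n) \<Rightarrow> 'a \<Rightarrow> real) \<Rightarrow> bool" where
  "parallel_02 M A D \<alpha> \<longleftrightarrow>
     (\<forall>X Y Z. smooth_vector_field A X \<longrightarrow> smooth_vector_field A Y \<longrightarrow> smooth_vector_field A Z \<longrightarrow>
        (\<forall>p\<in>topspace M.
           dir_deriv A p (X p) (\<alpha> Y Z) - \<alpha> (D X Y) Z p - \<alpha> Y (D X Z) p = 0))"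


section \<open>Almost paracontact metric structures and eta-Ricci solitons\<close>

definition eps_almost_paracontact_metric ::
  "'a topology \<Rightarrow> ('a, 'n::finite) chart set \<Rightarrow> ('a \<Rightarrow> real ^ 'n \<Rightarrow> real ^ 'n) \<Rightarrow>
     ('a \<Rightarrow> real ^ 'n) \<Rightarrow> ('a \<Rightarrow> real ^ 'n \<Rightarrow> real) \<Rightarrow>
     ('a \<Rightarrow> real ^ 'n \<Rightarrow> real ^ 'n \<Rightarrow> real) \<Rightarrow> real \<Rightarrow> bool" where
  "eps_almost_paracontact_metric M A \<phi> \<xi> \<eta> g \<epsilon> \<longleftrightarrow>
     tensor_field_11 M A \<phi> \<and> smooth_vector_field A \<xi> \<and> one_form M A \<eta> \<and>
     pseudo_riemannian_metric M A g \<and> \<epsilon> \<in> {1, -1} \<and>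
     (\<forall>p\<in>topspace M.
        (\<forall>v. \<phi> p (\<phi> p v) = v - \<eta> p v *\<^sub>R \<xi> p) \<and>
        \<eta> p (\<xi> p) = 1 \<and>
        \<phi> p (\<xi> p) = 0 \<and>
        (\<forall>v. \<eta> p (\<phi> p v) = 0) \<and>
        (\<forall>v w. g p (\<phi> p v) (\<phi> p w) = g p v w - \<epsilon> * \<eta> p v * \<eta> p w))"

text \<open>The left-hand side of the equation below is \<open>(D\<^sub>X \<phi>) Y = D\<^sub>X (\<phi> Y) - \<phi> (D\<^sub>X Y)\<close>.\<close>

definition eps_para_sasakian ::
  "'a topology \<Rightarrow> ('a, 'n::finite) chart set \<Rightarrow> ('a \<Rightarrow> real ^ 'n \<Rightarrow> real ^ 'n) \<Rightarrow>
     ('a \<Rightarrow> real ^ 'n) \<Rightarrow> ('a \<Rightarrow> real ^ 'n \<Rightarrow> real) \<Rightarrow>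
     ('a \<Rightarrow> real ^ 'n \<Rightarrow> real ^ 'n \<Rightarrow> real) \<Rightarrow> real \<Rightarrow>
     (('a \<Rightarrow> real ^ 'n) \<Rightarrow> ('a \<Rightarrow> real ^ 'n) \<Rightarrow> 'a \<Rightarrow> real ^ 'n) \<Rightarrow> bool" where
  "eps_para_sasakian M A \<phi> \<xi> \<eta> g \<epsilon> D \<longleftrightarrow>
     smooth_manifold M A \<and>
     eps_almost_paracontact_metric M A \<phi> \<xi> \<eta> g \<epsilon> \<and>
     levi_civita_connection M A g D \<and>
     (\<forall>X Y. smooth_vector_field A X \<longrightarrow> smooth_vector_field A Y \<longrightarrow>
        (\<forall>p\<in>topspace M.
           D X (\<lambda>q. \<phi> q (Y q)) p - \<phi> p (D X Y p) =
             - (g p (\<phi> p (X p)) (\<phi> p (Y p)) *\<^sub>R \<xi> p)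
             - (\<epsilon> * \<eta> p (Y p)) *\<^sub>R \<phi> p (\<phi> p (X p))))"

definition eta_ricci_soliton ::
  "'a topology \<Rightarrow> ('a, 'n::finite) chart set \<Rightarrow> ('a \<Rightarrow> real ^ 'n \<Rightarrow> real) \<Rightarrow>
     (('a \<Rightarrow> real ^ 'n) \<Rightarrow> ('a \<Rightarrow> real ^ 'n) \<Rightarrow> 'a \<Rightarrow> real ^ 'n) \<Rightarrow>
     ('a \<Rightarrow> real ^ 'n \<Rightarrow> real ^ 'n \<Rightarrow> real) \<Rightarrow> ('a \<Rightarrow> real ^ 'n) \<Rightarrow> real \<Rightarrow> real \<Rightarrow> bool" where
  "eta_ricci_soliton M A \<eta> D g \<xi> lam \<mu> \<longleftrightarrow>
     (\<forall>X Y. smooth_vector_field A X \<longrightarrow> smooth_vector_field A Y \<longrightarrow>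
        (\<forall>p\<in>topspace M.
           1/2 * lie_derivative_metric A \<xi> g X Y p + ricci A D X Y p +
             lam * g p (X p) (Y p) + \<mu> * \<eta> p (X p) * \<eta> p (Y p) = 0))"

end

theory Submission
  imports Defs
begin

text \<open>
  Write \<open>n\<close> for the dimension and \<open>\<nabla>\<close> for the connection \<open>D\<close>. The geometric core is short. Taking
  \<open>Y = \<xi>\<close> in the defining equation of \<open>\<nabla>\<phi>\<close> gives \<open>\<nabla>\<^sub>X\<xi> = \<epsilon> \<phi>X\<close> (\<open>D_xi\<close>), because \<open>\<phi>\<xi> = 0\<close> and
  \<open>g(\<xi>, \<xi>)\<close> is constant. As \<open>\<nabla>\<close> is torsion-free, \<open>\<onehalf> L\<^sub>\<xi>g(X, Y) = \<epsilon> g(\<phi>X, Y)\<close>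
  (\<open>half_lie_derivative_metric\<close>) and \<open>R(X, Y)\<xi> = \<eta>(X)Y - \<eta>(Y)X\<close> (\<open>curvature_xi\<close>); the trace of the
  latter is \<open>S(Y, \<xi>) = (1 - n) \<eta>(Y)\<close> (\<open>ricci_xi\<close>). Hence \<open>\<alpha>(Y, \<xi>) = c \<eta>(Y) = \<epsilon>c g(Y, \<xi>)\<close> with the
  constant \<open>c = 1 - n + \<mu>\<close>. In particular \<open>\<alpha>(\<xi>, \<xi>) = c\<close> at every point,
  so the number \<open>\<lambda> = -\<epsilon>c\<close> is determined and the soliton equation says \<open>\<alpha> = \<epsilon>c g\<close>.

  A constant multiple of \<open>g\<close> is parallel. Conversely, \<open>(\<nabla>\<^sub>X\<alpha>)(Y, \<xi>) = 0\<close> becomes, with the product rule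
  for \<open>\<alpha>(Y, \<xi>) = \<epsilon>c g(Y, \<xi>)\<close>, the identity \<open>\<alpha>(Y, \<nabla>\<^sub>X\<xi>) = \<epsilon>c g(Y, \<nabla>\<^sub>X\<xi>)\<close>. For \<open>X = \<phi>Z\<close> one has
  \<open>\<nabla>\<^sub>X\<xi> = \<epsilon>(Z - \<eta>(Z)\<xi>)\<close>, and as the two forms already agree on the pairs \<open>(Y, \<xi>)\<close>, they agree on all
  pairs \<open>(Y, Z)\<close>.

  The last step splits \<open>\<alpha>(Y, Z - \<eta>(Z)\<xi>)\<close> and hence needs that the curvature is linear over functions
  in its last argument (\<open>curvature_scale\<close>). This rests on \<open>[X, Y]f = X(Yf) - Y(Xf)\<close>
  (\<open>dir_deriv_lie_bracket\<close>): the bracket is defined by a description operator, so a vector with this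
  property has to be constructed, which is done in a chart with the symmetry of second derivatives, and
  it has to be unique, which requires sufficiently many global smooth functions. Likewise the trace
  in the Ricci tensor is taken over globally extended tangent vectors, which have to exist. Both
  needs are met by cutting off objects living in a chart with a bump function built from
  \<open>exp(-1/t)\<close>.
\<close>

section \<open>Calculus of smooth maps\<close>

lemma Ck_on_cong:
  assumes "open S" "\<And>x. x \<in> S \<Longrightarrow> f x = g x"
  shows "Ck_on k S f \<longleftrightarrow> Ck_on k S g"
  using assms(2)
proof (induction k arbitrary: f g)
  case 0
  then show ?case by (simp cong: continuous_on_cong)
next
  case (Suc k)
  have diff: "f differentiable (at x) \<longleftrightarrow> g differentiable (at x)" if "x \<in> S" for x
    using has_derivative_transform_within_open[OF _ \<open>open S\<close> that, of f _ UNIV g]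
      has_derivative_transform_within_open[OF _ \<open>open S\<close> that, of g _ UNIV f] Suc.prems
    by (auto simp: differentiable_def)
  show ?case
  proof (cases "\<forall>x\<in>S. f differentiable (at x)")
    case True
    have "frechet_derivative f (at x) v = frechet_derivative g (at x) v" if "x \<in> S" for x v
      using frechet_derivative_transform_within_open[of f x S g] True assms(1) Suc.prems that by simp
    then have "Ck_on k S (\<lambda>x. frechet_derivative f (at x) v) \<longleftrightarrow> 
        Ck_on k S (\<lambda>x. frechet_derivative g (at x) v)" for v
      by (intro Suc.IH) auto
    with diff show ?thesis by auto
  qed (use diff in auto)
qed

lemma Ck_on_SucD: "Ck_on (Suc k) S f \<Longrightarrow> Ck_on k S f"
proof (induction k arbitrary: f)
  case 0
  then show ?case
    by (auto intro!: continuous_at_imp_continuous_on differentiable_imp_continuous_within)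
next
  case (Suc k)
  then have "Ck_on k S (\<lambda>x. frechet_derivative f (at x) v)" for v
    by (metis Ck_on.simps(2))
  then show ?case using Suc.prems by simp
qed

lemma Ck_on_const: "Ck_on k S (\<lambda>x. c)"
  by (induction k arbitrary: c) auto

lemma Ck_on_bounded_linear_compose:
  assumes L: "bounded_linear L" and "open S" and "Ck_on k S f"
  shows "Ck_on k S (\<lambda>x. L (f x))"
  using assms(3)
proof (induction k arbitrary: f)
  case 0
  then show ?case by (simp add: bounded_linear.continuous_on[OF L])
next
  case (Suc k)
  have d: "((\<lambda>x. L (f x)) has_derivative (\<lambda>v. L (frechet_derivative f (at x) v))) (at x)" if "x \<in> S" for x
    using Suc.prems that by (auto simp: frechet_derivative_works[symmetric] intro!: bounded_linear.has_derivative[OF L])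
  have "Ck_on k S (\<lambda>x. frechet_derivative (\<lambda>x. L (f x)) (at x) v)" for v
  proof (subst Ck_on_cong[OF \<open>open S\<close>])
    show "frechet_derivative (\<lambda>x. L (f x)) (at x) v = L (frechet_derivative f (at x) v)" if "x \<in> S" for x
      using frechet_derivative_at[OF d[OF that]] by metis
    show "Ck_on k S (\<lambda>x. L (frechet_derivative f (at x) v))"
      using Suc by simp
  qed
  then show ?case using d by (auto simp: differentiable_def)
qed

lemma Ck_on_add:
  assumes "open S" "Ck_on k S f" "Ck_on k S g"
  shows "Ck_on k S (\<lambda>x. f x + g x)"
  using assms(2,3)
proof (induction k arbitrary: f g)
  case 0
  then show ?case by (simp add: continuous_on_add)
next
  case (Suc k)
  have d: "((\<lambda>x. f x + g x) has_derivative
      (\<lambda>v. frechet_derivative f (at x) v + frechet_derivative g (at x) v)) (at x)" if "x \<in> S" for x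
    using Suc.prems that by (auto simp: frechet_derivative_works[symmetric] intro!: has_derivative_add)
  have "Ck_on k S (\<lambda>x. frechet_derivative (\<lambda>x. f x + g x) (at x) v)" for v
  proof (subst Ck_on_cong[OF \<open>open S\<close>])
    show "frechet_derivative (\<lambda>x. f x + g x) (at x) v =
      frechet_derivative f (at x) v + frechet_derivative g (at x) v" if "x \<in> S" for x
      using frechet_derivative_at[OF d[OF that]] by metis
    show "Ck_on k S (\<lambda>x. frechet_derivative f (at x) v + frechet_derivative g (at x) v)"
      using Suc by simp
  qed
  then show ?case using d by (auto simp: differentiable_def)
qed

lemma Ck_on_sum:
  assumes "open S" "\<And>i. i \<in> I \<Longrightarrow> Ck_on k S (f i)"
  shows "Ck_on k S (\<lambda>x. \<Sum>i\<in>I. f i x)"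
  using assms(2)
  by (induction I rule: infinite_finite_induct) (auto intro!: Ck_on_const Ck_on_add assms(1))

lemma Ck_on_bilinear:
  assumes B: "bounded_bilinear B" and "open S" "Ck_on k S f" "Ck_on k S g"
  shows "Ck_on k S (\<lambda>x. B (f x) (g x))"
  using assms(3,4)
proof (induction k arbitrary: f g)
  case 0
  then show ?case by (simp add: bounded_bilinear.continuous_on[OF B])
next
  case (Suc k)
  have d: "((\<lambda>x. B (f x) (g x)) has_derivative
      (\<lambda>v. B (f x) (frechet_derivative g (at x) v) + B (frechet_derivative f (at x) v) (g x))) (at x)" if "x \<in> S" for x
    using Suc.prems that by (auto simp: frechet_derivative_works[symmetric] intro!: bounded_bilinear.FDERIV[OF B])
  have "Ck_on k S (\<lambda>x. frechet_derivative (\<lambda>x. B (f x) (g x)) (at x) v)" for v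
  proof (subst Ck_on_cong[OF \<open>open S\<close>])
    show "frechet_derivative (\<lambda>x. B (f x) (g x)) (at x) v =
      B (f x) (frechet_derivative g (at x) v) + B (frechet_derivative f (at x) v) (g x)" if "x \<in> S" for x
      using frechet_derivative_at[OF d[OF that]] by metis
    show "Ck_on k S (\<lambda>x. B (f x) (frechet_derivative g (at x) v) + B (frechet_derivative f (at x) v) (g x))"
      using Suc.prems Suc.prems[THEN Ck_on_SucD] by (intro Ck_on_add \<open>open S\<close> Suc.IH) auto
  qed
  then show ?case using d by (auto simp: differentiable_def)
qed

lemma linear_eq_sum_Basis:
  fixes h :: "'c::euclidean_space \<Rightarrow> 'd::real_vector"
  assumes "linear h" shows "h v = (\<Sum>i\<in>Basis. (v \<bullet> i) *\<^sub>R h i)"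
proof -
  have "h v = h (\<Sum>i\<in>Basis. (v \<bullet> i) *\<^sub>R i)" by (simp add: euclidean_representation)
  also have "\<dots> = (\<Sum>i\<in>Basis. (v \<bullet> i) *\<^sub>R h i)"
    using assms by (simp add: linear_sum linear_scale)
  finally show ?thesis .
qed

text \<open>
  By the chain rule the directional derivatives of \<open>g \<circ> f\<close> are sums of products of directional
  derivatives of \<open>f\<close> with partial derivatives of \<open>g\<close> composed with \<open>f\<close>. Expanding in a basis is what
  makes the induction close: the direction \<open>frechet_derivative f (at x) v\<close>, which varies with \<open>x\<close>, is
  replaced by the fixed basis vectors, to which the induction hypothesis applies.
\<close>

lemma Ck_on_compose:
  fixes f :: "'b::euclidean_space \<Rightarrow> 'c::euclidean_space" and g :: "'c \<Rightarrow> 'd::real_normed_vector"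
  assumes "open S" "Ck_on k S f" "Ck_on k T g" "f ` S \<subseteq> T"
  shows "Ck_on k S (\<lambda>x. g (f x))"
  using assms(2,3)
proof (induction k arbitrary: g)
  case 0
  then show ?case using assms(4) by (auto intro: continuous_on_compose2)
next
  case (Suc k)
  have dg: "(g has_derivative frechet_derivative g (at (f x))) (at (f x))" if "x \<in> S" for x
    using Suc.prems that assms(4) by (auto simp: image_subset_iff frechet_derivative_works[symmetric])
  have d: "((\<lambda>x. g (f x)) has_derivative
      (\<lambda>v. frechet_derivative g (at (f x)) (frechet_derivative f (at x) v))) (at x)" if "x \<in> S" for x
    using Suc.prems that
    by (intro has_derivative_compose[where f = f and g = g, OF _ dg[OF that]])
      (auto simp: frechet_derivative_works[symmetric])
  have "Ck_on k S (\<lambda>x. frechet_derivative (\<lambda>x. g (f x)) (at x) v)" for v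
  proof (subst Ck_on_cong[OF \<open>open S\<close>])
    show "frechet_derivative (\<lambda>x. g (f x)) (at x) v =
      (\<Sum>i\<in>Basis. (frechet_derivative f (at x) v \<bullet> i) *\<^sub>R frechet_derivative g (at (f x)) i)" if "x \<in> S" for x
      using frechet_derivative_at[OF d[OF that]] linear_eq_sum_Basis[OF has_derivative_linear[OF dg[OF that]]]
      by metis
    show "Ck_on k S (\<lambda>x. (\<Sum>i\<in>Basis. (frechet_derivative f (at x) v \<bullet> i) *\<^sub>R frechet_derivative g (at (f x)) i))"
    proof (intro Ck_on_sum Ck_on_bilinear[OF bounded_bilinear_scaleR] \<open>open S\<close>)
      fix i :: 'c
      show "Ck_on k S (\<lambda>x. frechet_derivative f (at x) v \<bullet> i)"
        using Suc.prems
        by (intro Ck_on_bounded_linear_compose[OF bounded_linear_inner_left] \<open>open S\<close>) auto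
      show "Ck_on k S (\<lambda>x. frechet_derivative g (at (f x)) i)"
        using Suc.prems Suc.prems(1)[THEN Ck_on_SucD] by (intro Suc.IH) auto
    qed
  qed
  then show ?case using d by (auto simp: differentiable_def)
qed

text \<open>
  The gluing principle by which a map vanishing off a compact subset of a chart will be
  recognised as smooth, on the two open sets of an open cover.
\<close>

lemma Ck_on_local:
  assumes "\<And>x. x \<in> S \<Longrightarrow> \<exists>T. open T \<and> x \<in> T \<and> Ck_on k T f"
  shows "Ck_on k S f"
  using assms
proof (induction k arbitrary: f)
  case 0
  then have "\<forall>x\<in>S. isCont f x"
    by (metis Ck_on.simps(1) continuous_on_eq_continuous_at)
  then show ?case by (simp add: continuous_at_imp_continuous_on)
next
  case (Suc k)
  have "f differentiable (at x)" if "x \<in> S" for x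
    using Suc.prems[OF that] by auto
  moreover have "Ck_on k S (\<lambda>x. frechet_derivative f (at x) v)" for v
    using Suc.prems by (intro Suc.IH) fastforce
  ultimately show ?case by simp
qed

lemma smooth_on_cong:
  "open S \<Longrightarrow> (\<And>x. x \<in> S \<Longrightarrow> f x = g x) \<Longrightarrow> smooth_on S f \<longleftrightarrow> smooth_on S g"
  using Ck_on_cong[of S f g] by (auto simp: smooth_on_def)

lemma smooth_on_const: "smooth_on S (\<lambda>x. c)"
  by (simp add: smooth_on_def Ck_on_const)

lemma smooth_on_add:
  "open S \<Longrightarrow> smooth_on S f \<Longrightarrow> smooth_on S g \<Longrightarrow> smooth_on S (\<lambda>x. f x + g x)"
  by (simp add: smooth_on_def Ck_on_add)

lemma smooth_on_sum:
  "open S \<Longrightarrow> (\<And>i. i \<in> I \<Longrightarrow> smooth_on S (f i)) \<Longrightarrow> smooth_on S (\<lambda>x. \<Sum>i\<in>I. f i x)"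
  by (simp add: smooth_on_def Ck_on_sum)

lemma smooth_on_bilinear:
  "bounded_bilinear B \<Longrightarrow> open S \<Longrightarrow> smooth_on S f \<Longrightarrow> smooth_on S g \<Longrightarrow>
    smooth_on S (\<lambda>x. B (f x) (g x))"
  by (simp add: smooth_on_def Ck_on_bilinear)

lemmas smooth_on_scaleR = smooth_on_bilinear[OF bounded_bilinear_scaleR]

lemmas smooth_on_mult = smooth_on_bilinear[OF bounded_bilinear_mult]

lemma smooth_on_bounded_linear_compose:
  "bounded_linear L \<Longrightarrow> open S \<Longrightarrow> smooth_on S f \<Longrightarrow> smooth_on S (\<lambda>x. L (f x))"
  by (simp add: smooth_on_def Ck_on_bounded_linear_compose)

lemma smooth_on_compose:
  fixes f :: "'b::euclidean_space \<Rightarrow> 'c::euclidean_space"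
  shows "open S \<Longrightarrow> smooth_on S f \<Longrightarrow> smooth_on T g \<Longrightarrow> f ` S \<subseteq> T \<Longrightarrow> smooth_on S (\<lambda>x. g (f x))"
  using Ck_on_compose[of S _ f T g] by (auto simp: smooth_on_def)

lemma smooth_on_local:
  "(\<And>x. x \<in> S \<Longrightarrow> \<exists>T. open T \<and> x \<in> T \<and> smooth_on T f) \<Longrightarrow> smooth_on S f"
  unfolding smooth_on_def
proof
  fix k assume "\<And>x. x \<in> S \<Longrightarrow> \<exists>T. open T \<and> x \<in> T \<and> (\<forall>k. Ck_on k T f)"
  then show "Ck_on k S f" by (intro Ck_on_local) metis
qed

lemma smooth_on_has_derivative:
  assumes "smooth_on S f" "x \<in> S"
  shows "(f has_derivative frechet_derivative f (at x)) (at x)"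
proof -
  have "Ck_on (Suc 0) S f" using assms by (simp add: smooth_on_def del: Ck_on.simps)
  then show ?thesis using assms frechet_derivative_works by auto
qed

lemma smooth_on_frechet_derivative:
  assumes "smooth_on S f"
  shows "smooth_on S (\<lambda>x. frechet_derivative f (at x) v)"
  unfolding smooth_on_def
proof
  fix k
  have "Ck_on (Suc k) S f" using assms by (simp add: smooth_on_def del: Ck_on.simps)
  then show "Ck_on k S (\<lambda>x. frechet_derivative f (at x) v)" by simp
qed

lemma smooth_on_frechet_derivative_along:
  fixes y :: "'b::euclidean_space \<Rightarrow> 'b"
  assumes "open S" "smooth_on S f" "smooth_on S y"
  shows "smooth_on S (\<lambda>x. frechet_derivative f (at x) (y x))"
proof (subst smooth_on_cong[OF \<open>open S\<close>])
  show "frechet_derivative f (at x) (y x) = (\<Sum>i\<in>Basis. (y x \<bullet> i) *\<^sub>R frechet_derivative f (at x) i)" if "x \<in> S" for x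
    using linear_eq_sum_Basis[OF has_derivative_linear[OF smooth_on_has_derivative[OF assms(2) that]]] .
  show "smooth_on S (\<lambda>x. \<Sum>i\<in>Basis. (y x \<bullet> i) *\<^sub>R frechet_derivative f (at x) i)"
    by (intro smooth_on_sum smooth_on_scaleR smooth_on_frechet_derivative assms
        smooth_on_bounded_linear_compose[OF bounded_linear_inner_left])
qed

lemma smooth_on_linear:
  fixes L :: "'b::euclidean_space \<Rightarrow> 'c::real_normed_vector"
  assumes "linear L" shows "smooth_on S L"
  unfolding smooth_on_def
proof
  fix k
  have b: "bounded_linear L" using assms by (simp add: linear_conv_bounded_linear)
  show "Ck_on k S L"
  proof (cases k)
    case 0
    then show ?thesis by (simp add: linear_continuous_on[OF b])
  next
    case (Suc j)
    have d: "(L has_derivative L) (at x)" for x using b by (rule bounded_linear_imp_has_derivative)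
    then have "frechet_derivative L (at x) = L" for x using frechet_derivative_at by metis
    then show ?thesis using Suc d by (auto simp: Ck_on_const differentiable_def)
  qed
qed

text \<open>
  The second difference of \<open>f\<close> along \<open>v\<close> and \<open>w\<close> is symmetric in the two directions. The mean value
  theorem, used first along \<open>v\<close> and then along \<open>w\<close>, identifies it with \<open>h\<^sup>2\<close> times the mixed derivative
  at some nearby point; using the directions in the other order gives the other mixed derivative.
  Letting \<open>h\<close> tend to zero yields the symmetry of second derivatives.
\<close>

lemma second_difference_mean_value:
  fixes f :: "'b::euclidean_space \<Rightarrow> real"
  assumes f: "smooth_on S f" and h: "h > 0"
    and in_S: "\<And>s t. 0 \<le> s \<Longrightarrow> s \<le> h \<Longrightarrow> 0 \<le> t \<Longrightarrow> t \<le> h \<Longrightarrow> x + s *\<^sub>R v + t *\<^sub>R w \<in> S"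
  shows "\<exists>s t. 0 \<le> s \<and> s \<le> h \<and> 0 \<le> t \<and> t \<le> h \<and>
    f (x + h *\<^sub>R v + h *\<^sub>R w) - f (x + h *\<^sub>R v) - f (x + h *\<^sub>R w) + f x =
    h * h * frechet_derivative (\<lambda>y. frechet_derivative f (at y) v) (at (x + s *\<^sub>R v + t *\<^sub>R w)) w"
proof -
  define F where "F y = frechet_derivative f (at y) v" for y
  have F: "smooth_on S F" unfolding F_def by (rule smooth_on_frechet_derivative[OF f])
  have df: "((\<lambda>s. f (x + s *\<^sub>R v + t *\<^sub>R w)) has_real_derivative F (x + s *\<^sub>R v + t *\<^sub>R w)) (at s)"
    if "0 \<le> s" "s \<le> h" "0 \<le> t" "t \<le> h" for s t
  proof -
    note d = smooth_on_has_derivative[OF f in_S[OF that]]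
    have "((\<lambda>s. f (x + s *\<^sub>R v + t *\<^sub>R w)) has_derivative
        (\<lambda>r. frechet_derivative f (at (x + s *\<^sub>R v + t *\<^sub>R w)) (r *\<^sub>R v))) (at s)"
      by (rule has_derivative_compose[where f = "\<lambda>s. x + s *\<^sub>R v + t *\<^sub>R w" and g = f, OF _ d]) (auto intro!: derivative_eq_intros)
    moreover have "(\<lambda>r. frechet_derivative f (at (x + s *\<^sub>R v + t *\<^sub>R w)) (r *\<^sub>R v)) =
        (*) (F (x + s *\<^sub>R v + t *\<^sub>R w))"
      using linear_scale[OF has_derivative_linear[OF d]] by (auto simp: F_def mult.commute)
    ultimately show ?thesis by (simp only: has_field_derivative_def)
  qed
  have dF: "((\<lambda>t. F (x + s *\<^sub>R v + t *\<^sub>R w)) has_real_derivative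
      frechet_derivative F (at (x + s *\<^sub>R v + t *\<^sub>R w)) w) (at t)"
    if "0 \<le> s" "s \<le> h" "0 \<le> t" "t \<le> h" for s t
  proof -
    note d = smooth_on_has_derivative[OF F in_S[OF that]]
    have "((\<lambda>t. F (x + s *\<^sub>R v + t *\<^sub>R w)) has_derivative
        (\<lambda>r. frechet_derivative F (at (x + s *\<^sub>R v + t *\<^sub>R w)) (r *\<^sub>R w))) (at t)"
      by (rule has_derivative_compose[where f = "\<lambda>t. x + s *\<^sub>R v + t *\<^sub>R w" and g = F, OF _ d]) (auto intro!: derivative_eq_intros)
    moreover have "(\<lambda>r. frechet_derivative F (at (x + s *\<^sub>R v + t *\<^sub>R w)) (r *\<^sub>R w)) =
        (*) (frechet_derivative F (at (x + s *\<^sub>R v + t *\<^sub>R w)) w)"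
      using linear_scale[OF has_derivative_linear[OF d]] by (auto simp: mult.commute)
    ultimately show ?thesis by (simp only: has_field_derivative_def)
  qed
  define G where "G s = f (x + s *\<^sub>R v + h *\<^sub>R w) - f (x + s *\<^sub>R v + 0 *\<^sub>R w)" for s
  have "\<exists>z. z > 0 \<and> z < h \<and> G h - G 0 = (h - 0) *
      (F (x + z *\<^sub>R v + h *\<^sub>R w) - F (x + z *\<^sub>R v + 0 *\<^sub>R w))"
    unfolding G_def using h by (intro MVT2 DERIV_diff df) auto
  then obtain z where z: "z > 0" "z < h" "G h - G 0 = h *
      (F (x + z *\<^sub>R v + h *\<^sub>R w) - F (x + z *\<^sub>R v + 0 *\<^sub>R w))" by auto
  have "\<exists>t. t > 0 \<and> t < h \<and> F (x + z *\<^sub>R v + h *\<^sub>R w) - F (x + z *\<^sub>R v + 0 *\<^sub>R w) =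
      (h - 0) * frechet_derivative F (at (x + z *\<^sub>R v + t *\<^sub>R w)) w"
    using h z by (intro MVT2 dF) auto
  then obtain t where t: "t > 0" "t < h" "F (x + z *\<^sub>R v + h *\<^sub>R w) - F (x + z *\<^sub>R v + 0 *\<^sub>R w) =
      h * frechet_derivative F (at (x + z *\<^sub>R v + t *\<^sub>R w)) w" by auto
  have "f (x + h *\<^sub>R v + h *\<^sub>R w) - f (x + h *\<^sub>R v) - f (x + h *\<^sub>R w) + f x =
      h * h * frechet_derivative F (at (x + z *\<^sub>R v + t *\<^sub>R w)) w"
    using z(3) t(3) by (simp add: G_def)
  then show ?thesis unfolding F_def[abs_def] using z t by (meson less_imp_le)
qed

lemma symmetric_second_derivative:
  fixes f :: "'b::euclidean_space \<Rightarrow> real"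
  assumes "open S" and f: "smooth_on S f" and "x \<in> S"
  shows "frechet_derivative (\<lambda>y. frechet_derivative f (at y) v) (at x) w =
    frechet_derivative (\<lambda>y. frechet_derivative f (at y) w) (at x) v"
proof -
  define P where "P y = frechet_derivative (\<lambda>y. frechet_derivative f (at y) v) (at y) w" for y
  define Q where "Q y = frechet_derivative (\<lambda>y. frechet_derivative f (at y) w) (at y) v" for y
  have "smooth_on S P" "smooth_on S Q"
    unfolding P_def Q_def by (intro smooth_on_frechet_derivative f)+
  then have "isCont P x" "isCont Q x"
    using smooth_on_has_derivative has_derivative_continuous \<open>x \<in> S\<close> by blast+
  have "P x = Q x"
  proof (rule ccontr)
    assume ne: "P x \<noteq> Q x"
    define e where "e = \<bar>P x - Q x\<bar> / 2"
    have e: "e > 0" using ne by (simp add: e_def)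
    obtain d1 where d1: "d1 > 0" "\<And>y. dist y x < d1 \<Longrightarrow> dist (P y) (P x) < e"
      using \<open>isCont P x\<close> e unfolding continuous_at_eps_delta by blast
    obtain d2 where d2: "d2 > 0" "\<And>y. dist y x < d2 \<Longrightarrow> dist (Q y) (Q x) < e"
      using \<open>isCont Q x\<close> e unfolding continuous_at_eps_delta by blast
    obtain d3 where d3: "d3 > 0" "ball x d3 \<subseteq> S"
      using \<open>open S\<close> \<open>x \<in> S\<close> open_contains_ball by blast
    define d where "d = min d1 (min d2 d3)"
    define h where "h = d / (2 * (norm v + norm w + 1))"
    have d: "d > 0" using d1 d2 d3 by (simp add: d_def)
    have n: "norm v + norm w + 1 > 0" by (simp add: add_nonneg_pos)
    have h: "h > 0" unfolding h_def using d n by (auto intro!: divide_pos_pos)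
    have near: "dist (x + s *\<^sub>R v + t *\<^sub>R w) x < d"
      if "0 \<le> s" "s \<le> h" "0 \<le> t" "t \<le> h" for s t
    proof -
      have "dist (x + s *\<^sub>R v + t *\<^sub>R w) x = norm (s *\<^sub>R v + t *\<^sub>R w)"
        by (simp add: dist_norm add.assoc)
      also have "\<dots> \<le> s * norm v + t * norm w"
        using norm_triangle_ineq[of "s *\<^sub>R v" "t *\<^sub>R w"] that by simp
      also have "\<dots> \<le> h * norm v + h * norm w"
        using that by (intro add_mono mult_right_mono) auto
      also have "\<dots> \<le> h * (norm v + norm w + 1)" using h by (simp add: algebra_simps)
      also have "\<dots> = d / 2" using n by (simp add: h_def field_simps)
      also have "\<dots> < d" using d by simp
      finally show ?thesis .
    qed
    have near': "dist (x + s *\<^sub>R w + t *\<^sub>R v) x < d"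
      if "0 \<le> s" "s \<le> h" "0 \<le> t" "t \<le> h" for s t
      using near[of t s] that by (simp add: add.assoc add.commute[of "s *\<^sub>R w"])
    have sub: "y \<in> S" if "dist y x < d" for y
      using that d3 by (auto simp: d_def dist_commute)
    obtain s t where st: "0 \<le> s" "s \<le> h" "0 \<le> t" "t \<le> h"
      "f (x + h *\<^sub>R v + h *\<^sub>R w) - f (x + h *\<^sub>R v) - f (x + h *\<^sub>R w) + f x =
       h * h * P (x + s *\<^sub>R v + t *\<^sub>R w)"
      unfolding P_def using second_difference_mean_value[OF f h sub[OF near]] by blast
    obtain s' t' where st': "0 \<le> s'" "s' \<le> h" "0 \<le> t'" "t' \<le> h"
      "f (x + h *\<^sub>R w + h *\<^sub>R v) - f (x + h *\<^sub>R w) - f (x + h *\<^sub>R v) + f x =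
       h * h * Q (x + s' *\<^sub>R w + t' *\<^sub>R v)"
      unfolding Q_def using second_difference_mean_value[OF f h sub[OF near']] by blast
    have "f (x + h *\<^sub>R w + h *\<^sub>R v) = f (x + h *\<^sub>R v + h *\<^sub>R w)"
      by (simp add: algebra_simps)
    then have "h * h * P (x + s *\<^sub>R v + t *\<^sub>R w) = h * h * Q (x + s' *\<^sub>R w + t' *\<^sub>R v)"
      using st(5) st'(5) by argo
    then have eq: "P (x + s *\<^sub>R v + t *\<^sub>R w) = Q (x + s' *\<^sub>R w + t' *\<^sub>R v)"
      using h by simp
    have "dist (P (x + s *\<^sub>R v + t *\<^sub>R w)) (P x) < e"
      using near[OF st(1-4)] by (intro d1) (simp add: d_def)
    moreover have "dist (Q (x + s' *\<^sub>R w + t' *\<^sub>R v)) (Q x) < e"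
      using near'[OF st'(1-4)] by (intro d2) (simp add: d_def)
    ultimately have "\<bar>P x - Q x\<bar> < 2 * e" using eq by (simp add: dist_real_def)
    then show False by (simp add: e_def)
  qed
  then show ?thesis by (simp add: P_def Q_def)
qed

text \<open>
  The product rule for a vector field \<open>y\<close> acting on a function \<open>f\<close>. The second summand has \<open>y\<close> frozen
  at the point \<open>a\<close>, so that the symmetry of second derivatives applies to it; it is the part that
  cancels in a commutator.
\<close>

lemma frechet_derivative_along:
  fixes f :: "'b::euclidean_space \<Rightarrow> real"
  assumes S: "open S" and f: "smooth_on S f" and y: "smooth_on S y" and "a \<in> S"
  shows "frechet_derivative (\<lambda>u. frechet_derivative f (at u) (y u)) (at a) w =
    frechet_derivative f (at a) (frechet_derivative y (at a) w) +
    frechet_derivative (\<lambda>u. frechet_derivative f (at u) (y a)) (at a) w"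
proof -
  let ?D = "\<lambda>i u. frechet_derivative f (at u) i"
  have lin: "linear (frechet_derivative f (at u))" if "u \<in> S" for u
    using has_derivative_linear[OF smooth_on_has_derivative[OF f that]] .
  have expand: "frechet_derivative f (at u) v = (\<Sum>i\<in>Basis. (v \<bullet> i) * ?D i u)" if "u \<in> S" for u v
    using linear_eq_sum_Basis[OF lin[OF that], of v] by simp
  have dD: "(?D i has_derivative frechet_derivative (?D i) (at a)) (at a)" for i
    by (rule smooth_on_has_derivative[OF smooth_on_frechet_derivative[OF f] \<open>a \<in> S\<close>])
  have dy: "((\<lambda>u. y u \<bullet> i) has_derivative (\<lambda>w. frechet_derivative y (at a) w \<bullet> i)) (at a)" for i
    by (rule has_derivative_inner_left[OF smooth_on_has_derivative[OF y \<open>a \<in> S\<close>]])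
  have "((\<lambda>u. \<Sum>i\<in>Basis. (y u \<bullet> i) * ?D i u) has_derivative
      (\<lambda>w. \<Sum>i\<in>Basis. (y a \<bullet> i) * frechet_derivative (?D i) (at a) w +
         (frechet_derivative y (at a) w \<bullet> i) * ?D i a)) (at a)"
    by (intro has_derivative_sum has_derivative_mult dD dy)
  then have along: "((\<lambda>u. frechet_derivative f (at u) (y u)) has_derivative
      (\<lambda>w. \<Sum>i\<in>Basis. (y a \<bullet> i) * frechet_derivative (?D i) (at a) w +
         (frechet_derivative y (at a) w \<bullet> i) * ?D i a)) (at a)"
    by (rule has_derivative_transform_within_open[OF _ S \<open>a \<in> S\<close>])
      (rule expand[symmetric])
  have "((\<lambda>u. \<Sum>i\<in>Basis. (y a \<bullet> i) * ?D i u) has_derivative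
      (\<lambda>w. \<Sum>i\<in>Basis. (y a \<bullet> i) * frechet_derivative (?D i) (at a) w)) (at a)"
    by (intro has_derivative_sum has_derivative_mult_right dD)
  then have frozen: "((\<lambda>u. frechet_derivative f (at u) (y a)) has_derivative
      (\<lambda>w. \<Sum>i\<in>Basis. (y a \<bullet> i) * frechet_derivative (?D i) (at a) w)) (at a)"
    by (rule has_derivative_transform_within_open[OF _ S \<open>a \<in> S\<close>])
      (rule expand[symmetric])
  show ?thesis
    unfolding frechet_derivative_at[OF along, symmetric] frechet_derivative_at[OF frozen, symmetric]
      sum.distrib
    by (subst expand[OF \<open>a \<in> S\<close>, of "frechet_derivative y (at a) w"]) simp
qed

text \<open>
  Equal germs have the same derivative even if there is none: the derivative is then an arbitrary
  choice, but a choice from the same set of candidates.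
\<close>

lemma frechet_derivative_cong_open:
  assumes "open S" "a \<in> S" "\<And>x. x \<in> S \<Longrightarrow> f x = g x"
  shows "frechet_derivative f (at a) = frechet_derivative g (at a)"
proof -
  have "(f has_derivative D) (at a) \<longleftrightarrow> (g has_derivative D) (at a)" for D
    using has_derivative_transform_within_open[OF _ assms(1,2), of f D UNIV g]
      has_derivative_transform_within_open[OF _ assms(1,2), of g D UNIV f] assms(3) by auto
  then show ?thesis by (simp add: frechet_derivative_def)
qed

section \<open>Bump functions\<close>

text \<open>
  The functions \<open>t\<^sup>-\<^sup>n exp(-1/t)\<close>, extended by zero to \<open>t \<le> 0\<close>. Each derivative is a combination of
  two members of the family, so that smoothness of all of them follows by one induction.
\<close>

definition flat_exp :: "nat \<Rightarrow> real \<Rightarrow> real" where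
  "flat_exp n t = (if t > 0 then inverse t ^ n * exp (- inverse t) else 0)"

lemma flat_exp_tendsto_0: "(flat_exp n \<longlongrightarrow> 0) (at 0)"
proof -
  have "((\<lambda>s. s ^ n / exp s) \<longlongrightarrow> 0) (at_top :: real filter)" by (rule tendsto_power_div_exp_0)
  then have "((\<lambda>t. inverse t ^ n / exp (inverse t)) \<longlongrightarrow> (0::real)) (at_right 0)"
    by (rule filterlim_compose[OF _ filterlim_inverse_at_top_right])
  then have "(flat_exp n \<longlongrightarrow> 0) (at_right 0)"
    by (rule Lim_transform_eventually)
      (auto simp: eventually_at_filter flat_exp_def exp_minus field_simps)
  moreover have "(flat_exp n \<longlongrightarrow> 0) (at_left 0)"
    by (rule Lim_transform_eventually[OF tendsto_const])
      (auto simp: eventually_at_filter flat_exp_def)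
  ultimately show ?thesis by (simp add: filterlim_split_at)
qed

lemma flat_exp_has_derivative:
  "(flat_exp n has_real_derivative flat_exp (n + 2) t - real n * flat_exp (n + 1) t) (at t)"
proof -
  consider "t > 0" | "t < 0" | "t = 0" by linarith
  then show ?thesis
  proof cases
    case 1
    have pow: "\<forall>m. m = 0 \<or> inverse t ^ m = inverse t * inverse t ^ (m - Suc 0)"
      by (metis One_nat_def power_eq_if)
    have "((\<lambda>t. inverse t ^ n * exp (- inverse t)) has_real_derivative
        flat_exp (n + 2) t - real n * flat_exp (n + 1) t) (at t)"
      using 1 pow
      by (cases n)
        (auto intro!: derivative_eq_intros simp: flat_exp_def algebra_simps power2_eq_square)
    then show ?thesis
      by (rule has_field_derivative_transform_within_open[of _ _ _ "{0<..}"])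
        (use 1 in \<open>auto simp: flat_exp_def\<close>)
  next
    case 2
    have "((\<lambda>t. 0) has_real_derivative flat_exp (n + 2) t - real n * flat_exp (n + 1) t) (at t)"
      using 2 by (simp add: flat_exp_def)
    then show ?thesis
      by (rule has_field_derivative_transform_within_open[of _ _ _ "{..<0}"])
        (use 2 in \<open>auto simp: flat_exp_def\<close>)
  next
    case 3
    have zero: "flat_exp m 0 = 0" for m by (simp add: flat_exp_def)
    have "(flat_exp n (0 + h) - flat_exp n 0) / h = flat_exp (n + 1) h" for h
      by (simp add: flat_exp_def field_simps)
    then show ?thesis
      using flat_exp_tendsto_0[of "n + 1"] 3 by (simp add: DERIV_def zero)
  qed
qed

lemma smooth_on_flat_exp: "smooth_on UNIV (flat_exp n)"
  unfolding smooth_on_def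
proof
  fix k
  show "Ck_on k UNIV (flat_exp n)"
  proof (induction k arbitrary: n)
    case 0
    then show ?case
      using DERIV_isCont[OF flat_exp_has_derivative] by (simp add: continuous_at_imp_continuous_on)
  next
    case (Suc k)
    have d: "(flat_exp n has_derivative (\<lambda>v. v *\<^sub>R (flat_exp (n + 2) t + (- real n) *\<^sub>R flat_exp (n + 1) t))) (at t)" for t
    proof -
      have "(\<lambda>v. v *\<^sub>R (flat_exp (n + 2) t + (- real n) *\<^sub>R flat_exp (n + 1) t)) =
          (*) (flat_exp (n + 2) t - real n * flat_exp (n + 1) t)"
        by (auto simp: mult.commute)
      then show ?thesis
        using flat_exp_has_derivative[of n t] by (simp only: has_field_derivative_def)
    qed
    have "frechet_derivative (flat_exp n) (at t) v = v *\<^sub>R (flat_exp (n + 2) t + (- real n) *\<^sub>R flat_exp (n + 1) t)" for t v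
      using frechet_derivative_at[OF d] by metis
    moreover have "Ck_on k UNIV (\<lambda>t. v *\<^sub>R (flat_exp (n + 2) t + (- real n) *\<^sub>R flat_exp (n + 1) t))" for v
      by (intro Ck_on_bilinear[OF bounded_bilinear_scaleR] Ck_on_add Ck_on_const Suc.IH open_UNIV)
    moreover have "flat_exp n differentiable (at t)" for t
      using d by (rule differentiableI)
    ultimately show ?case by simp
  qed
qed

text \<open>
  The function \<open>exp(-1/t)\<close> at \<open>t = r\<^sup>2 - |x - a|\<^sup>2\<close>, normalised at \<open>a\<close>. The value 1 at
  \<open>a\<close> is what keeps the value of a field, or the differential of a function vanishing at \<open>a\<close>, under
  multiplication with the bump function.
\<close>

lemma smooth_bump:
  fixes a :: "'b::euclidean_space"
  assumes "r > 0"
  shows "\<exists>b. smooth_on UNIV b \<and> b a = (1::real) \<and> (\<forall>x. b x \<noteq> 0 \<longrightarrow> x \<in> cball a r)"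
proof -
  define b where "b x = flat_exp 0 (r\<^sup>2 + (- 1) *\<^sub>R ((x - a) \<bullet> (x - a))) * inverse (flat_exp 0 (r\<^sup>2))" for x
  have "smooth_on UNIV (\<lambda>x. x - a)"
    using smooth_on_add[OF _ smooth_on_linear[OF linear_id] smooth_on_const[of _ "- a"]] by simp
  then have "smooth_on UNIV b"
    unfolding b_def
    by (intro smooth_on_mult smooth_on_const smooth_on_compose[OF _ _ smooth_on_flat_exp]
        smooth_on_add smooth_on_scaleR smooth_on_bilinear[OF bounded_bilinear_inner]) auto
  moreover have "b a = 1" using assms by (simp add: b_def flat_exp_def)
  moreover have "x \<in> cball a r" if "b x \<noteq> 0" for x
  proof -
    have "(x - a) \<bullet> (x - a) < r\<^sup>2"
      using that by (auto simp: b_def flat_exp_def split: if_splits)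
    then have "norm (x - a) < r"
      using assms by (simp add: power2_norm_eq_inner[symmetric] power_less_imp_less_base)
    then show ?thesis by (simp add: dist_norm norm_minus_commute)
  qed
  ultimately show ?thesis by blast
qed

section \<open>Charts, smooth functions and vector fields\<close>

definition jacobian ::
  "('a, 'n::finite) chart \<Rightarrow> ('a, 'n) chart \<Rightarrow> 'a \<Rightarrow> real ^ 'n \<Rightarrow> real ^ 'n" where
  "jacobian c d p = frechet_derivative (snd d \<circ> chart_inv c) (at (snd c p))"

lemma to_coords_jacobian: "to_coords A c p = jacobian (chart_at A p) c p"
  by (simp add: to_coords_def jacobian_def)

lemma from_coords_jacobian: "from_coords A c p = jacobian c (chart_at A p) p"
  by (simp add: from_coords_def jacobian_def)

locale manifold =
  fixes M :: "'a topology" and A :: "('a, 'n::finite) chart set"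
  assumes manifold: "smooth_manifold M A"
begin

lemma is_chart: "c \<in> A \<Longrightarrow> is_chart M c"
  using manifold by (simp add: smooth_manifold_def)

lemma Hausdorff: "Hausdorff_space M"
  using manifold by (simp add: smooth_manifold_def)

lemma openin_domain: "c \<in> A \<Longrightarrow> openin M (fst c)"
  using is_chart by (simp add: is_chart_def)

lemma domain_subset: "c \<in> A \<Longrightarrow> p \<in> fst c \<Longrightarrow> p \<in> topspace M"
  using openin_domain openin_subset by blast

lemma open_image_domain: "c \<in> A \<Longrightarrow> open (snd c ` fst c)"
  using is_chart by (simp add: is_chart_def)

lemma homeomorphic_chart:
  "c \<in> A \<Longrightarrow> homeomorphic_map (subtopology M (fst c)) (top_of_set (snd c ` fst c)) (snd c)"
  using is_chart by (simp add: is_chart_def)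

lemma inj_on_chart: "c \<in> A \<Longrightarrow> inj_on (snd c) (fst c)"
  using homeomorphic_imp_injective_map[OF homeomorphic_chart] openin_subset[OF openin_domain]
  by (metis topspace_subtopology_subset)

lemma chart_inv_chart [simp]: "c \<in> A \<Longrightarrow> p \<in> fst c \<Longrightarrow> chart_inv c (snd c p) = p"
  by (simp add: inj_on_chart)

lemma smooth_on_chart_cong:
  assumes "c \<in> A" "\<And>p. p \<in> fst c \<Longrightarrow> F (snd c p) = G (snd c p)"
  shows "smooth_on (snd c ` fst c) F \<longleftrightarrow> smooth_on (snd c ` fst c) G"
  by (rule smooth_on_cong[OF open_image_domain[OF assms(1)]]) (use assms(2) in blast)

lemma open_image_chart:
  assumes "c \<in> A" "openin M V" "V \<subseteq> fst c"
  shows "open (snd c ` V)"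
proof -
  have "openin (subtopology M (fst c)) V"
    using assms openin_subtopology_Int2[of M V "fst c"] by (simp add: Int_absorb1)
  then have "openin (top_of_set (snd c ` fst c)) (snd c ` V)"
    using homeomorphic_map_openness_eq[OF homeomorphic_chart[OF \<open>c \<in> A\<close>], of V] by blast
  then show ?thesis using open_image_domain[OF \<open>c \<in> A\<close>] openin_open_trans by blast
qed

lemma open_image_overlap: "c \<in> A \<Longrightarrow> d \<in> A \<Longrightarrow> open (snd c ` (fst c \<inter> fst d))"
  by (intro open_image_chart openin_Int openin_domain) auto

lemma smooth_transition:
  "c \<in> A \<Longrightarrow> d \<in> A \<Longrightarrow> smooth_on (snd c ` (fst c \<inter> fst d)) (snd d \<circ> chart_inv c)"
  using manifold by (simp add: smooth_manifold_def)

lemma chart_at: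
  assumes "p \<in> topspace M"
  shows chart_at_in_atlas: "chart_at A p \<in> A" and chart_at_contains: "p \<in> fst (chart_at A p)"
proof -
  have "(\<Union>c\<in>A. fst c) = topspace M"
    using manifold by (simp add: smooth_manifold_def)
  then have "\<exists>c. c \<in> A \<and> p \<in> fst c"
    using assms by blast
  from someI_ex[OF this] show "chart_at A p \<in> A" "p \<in> fst (chart_at A p)"
    by (auto simp: chart_at_def)
qed

lemma jacobian_has_derivative:
  assumes "c \<in> A" "d \<in> A" "p \<in> fst c" "p \<in> fst d"
  shows "((snd d \<circ> chart_inv c) has_derivative jacobian c d p) (at (snd c p))"
  unfolding jacobian_def
  by (rule smooth_on_has_derivative[OF smooth_transition]) (use assms in auto)

lemma linear_jacobian:
  "c \<in> A \<Longrightarrow> d \<in> A \<Longrightarrow> p \<in> fst c \<Longrightarrow> p \<in> fst d \<Longrightarrow> linear (jacobian c d p)"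
  by (rule has_derivative_linear[OF jacobian_has_derivative])

text \<open>
  The coordinate change behind all the comparisons of charts below: applied to a function it shows
  that \<^const>\<open>dir_deriv\<close> can be computed in any chart, applied to a coordinate map it gives the
  cocycle property of the Jacobians.
\<close>

lemma has_derivative_change_chart:
  assumes c: "c \<in> A" "p \<in> fst c" and d: "d \<in> A" "p \<in> fst d"
    and f: "((f \<circ> chart_inv d) has_derivative f') (at (snd d p))"
  shows "((f \<circ> chart_inv c) has_derivative (\<lambda>v. f' (jacobian c d p v))) (at (snd c p))"
proof -
  have "((\<lambda>u. (f \<circ> chart_inv d) ((snd d \<circ> chart_inv c) u)) has_derivative
      (\<lambda>v. f' (jacobian c d p v))) (at (snd c p))"
    by (rule has_derivative_compose[OF jacobian_has_derivative[OF c(1) d(1) c(2) d(2)]])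
      (use f c d in \<open>simp add: o_def\<close>)
  then show ?thesis
    by (rule has_derivative_transform_within_open[OF _ open_image_overlap[OF c(1) d(1)]])
      (use c d in auto)
qed

lemma jacobian_compose:
  assumes "c \<in> A" "d \<in> A" "e \<in> A" "p \<in> fst c" "p \<in> fst d" "p \<in> fst e"
  shows "jacobian d e p (jacobian c d p v) = jacobian c e p v"
  using has_derivative_unique[OF has_derivative_change_chart[OF assms(1,4,2,5)
        jacobian_has_derivative[OF assms(2,3,5,6)]] jacobian_has_derivative[OF assms(1,3,4,6)]]
  by metis

lemma jacobian_self:
  assumes "c \<in> A" "p \<in> fst c"
  shows "jacobian c c p v = v"
proof -
  have "((\<lambda>u. u) has_derivative (\<lambda>v. v)) (at (snd c p))" by simp
  then have "((snd c \<circ> chart_inv c) has_derivative (\<lambda>v. v)) (at (snd c p))"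
    by (rule has_derivative_transform_within_open[OF _ open_image_domain[OF assms(1)]])
      (use assms in auto)
  from has_derivative_unique[OF this jacobian_has_derivative[OF assms(1,1,2,2)]]
  show ?thesis by metis
qed

lemma to_coords_from_coords:
  assumes "c \<in> A" "d \<in> A" "p \<in> fst c" "p \<in> fst d"
  shows "to_coords A d p (from_coords A c p v) = jacobian c d p v"
  using assms domain_subset chart_at
  by (simp add: to_coords_jacobian from_coords_jacobian jacobian_compose)

lemma to_coords_from_coords_same [simp]:
  "c \<in> A \<Longrightarrow> p \<in> fst c \<Longrightarrow> to_coords A c p (from_coords A c p v) = v"
  by (simp add: to_coords_from_coords jacobian_self)

lemma from_coords_to_coords [simp]:
  assumes "c \<in> A" "p \<in> fst c"
  shows "from_coords A c p (to_coords A c p v) = v"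
  using assms domain_subset[OF assms] chart_at
  by (simp add: to_coords_jacobian from_coords_jacobian jacobian_compose jacobian_self)

lemma linear_to_coords: "c \<in> A \<Longrightarrow> p \<in> fst c \<Longrightarrow> linear (to_coords A c p)"
  using domain_subset chart_at by (simp add: to_coords_jacobian linear_jacobian)

lemma linear_from_coords: "c \<in> A \<Longrightarrow> p \<in> fst c \<Longrightarrow> linear (from_coords A c p)"
  using domain_subset chart_at by (simp add: from_coords_jacobian linear_jacobian)

lemma smooth_function_cong:
  assumes "\<And>p. p \<in> topspace M \<Longrightarrow> f p = f' p"
  shows "smooth_function A f \<longleftrightarrow> smooth_function A f'"
  unfolding smooth_function_def
  by (intro ball_cong refl smooth_on_chart_cong) (simp_all add: assms domain_subset)

lemma smooth_function_const: "smooth_function A (\<lambda>p. k)"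
  by (simp add: smooth_function_def o_def smooth_on_const)

lemma smooth_function_mult:
  "smooth_function A f \<Longrightarrow> smooth_function A f' \<Longrightarrow> smooth_function A (\<lambda>p. f p * f' p)"
  by (simp add: smooth_function_def o_def smooth_on_mult open_image_domain)

lemma smooth_vector_field_cong:
  assumes "\<And>p. p \<in> topspace M \<Longrightarrow> X p = Y p"
  shows "smooth_vector_field A X \<longleftrightarrow> smooth_vector_field A Y"
  unfolding smooth_vector_field_def
  by (intro ball_cong refl smooth_on_chart_cong) (simp_all add: assms domain_subset)

lemma smooth_vector_field_add:
  assumes X: "smooth_vector_field A X" and Y: "smooth_vector_field A Y"
  shows "smooth_vector_field A (\<lambda>p. X p + Y p)"
  unfolding smooth_vector_field_def
proof
  fix c assume c: "c \<in> A"
  have "smooth_on (snd c ` fst c) (\<lambda>u. (let p = chart_inv c u in to_coords A c p (X p)) +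
      (let p = chart_inv c u in to_coords A c p (Y p)))"
    using X Y c by (intro smooth_on_add open_image_domain) (simp_all add: smooth_vector_field_def)
  then show "smooth_on (snd c ` fst c) (\<lambda>u. let p = chart_inv c u in to_coords A c p (X p + Y p))"
    by (subst smooth_on_chart_cong[OF c])
      (use c in \<open>simp_all add: linear_add[OF linear_to_coords] Let_def\<close>)
qed

lemma smooth_vector_field_scale:
  assumes f: "smooth_function A f" and X: "smooth_vector_field A X"
  shows "smooth_vector_field A (\<lambda>p. f p *\<^sub>R X p)"
  unfolding smooth_vector_field_def
proof
  fix c assume c: "c \<in> A"
  have "smooth_on (snd c ` fst c)
      (\<lambda>u. (f \<circ> chart_inv c) u *\<^sub>R (let p = chart_inv c u in to_coords A c p (X p)))"
    using f[unfolded smooth_function_def] X c by (intro smooth_on_scaleR open_image_domain)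
      (simp_all add: smooth_vector_field_def del: o_apply)
  then show "smooth_on (snd c ` fst c) (\<lambda>u. let p = chart_inv c u in to_coords A c p (f p *\<^sub>R X p))"
    by (subst smooth_on_chart_cong[OF c])
      (use c in \<open>simp_all add: linear_scale[OF linear_to_coords] Let_def\<close>)
qed

lemma smooth_vector_field_cmult:
  "smooth_vector_field A X \<Longrightarrow> smooth_vector_field A (\<lambda>p. k *\<^sub>R X p)"
  using smooth_vector_field_scale[OF smooth_function_const] .

lemma smooth_vector_field_diff:
  assumes X: "smooth_vector_field A X" and Y: "smooth_vector_field A Y"
  shows "smooth_vector_field A (\<lambda>p. X p - Y p)"
  using smooth_vector_field_add[OF X smooth_vector_field_cmult[OF Y, of "- 1"]] by simp

lemma dir_deriv_chart:
  assumes c: "c \<in> A" "p \<in> fst c"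
    and f: "(f \<circ> chart_inv c) differentiable (at (snd c p))"
  shows "dir_deriv A p v f = frechet_derivative (f \<circ> chart_inv c) (at (snd c p)) (to_coords A c p v)"
proof -
  have p: "p \<in> topspace M" using domain_subset[OF c] .
  show ?thesis
    using frechet_derivative_at[OF has_derivative_change_chart[OF chart_at[OF p] c
          f[unfolded frechet_derivative_works]]]
    unfolding dir_deriv_def to_coords_jacobian by metis
qed

lemma smooth_function_differentiable:
  assumes "smooth_function A f" "c \<in> A" "p \<in> fst c"
  shows "(f \<circ> chart_inv c) differentiable (at (snd c p))"
proof -
  have "smooth_on (snd c ` fst c) (f \<circ> chart_inv c)"
    using assms by (simp add: smooth_function_def)
  from smooth_on_has_derivative[OF this, of "snd c p"] show ?thesis
    using assms by (simp add: frechet_derivative_works)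
qed

lemma dir_deriv_smooth:
  "smooth_function A f \<Longrightarrow> c \<in> A \<Longrightarrow> p \<in> fst c \<Longrightarrow>
    dir_deriv A p v f = frechet_derivative (f \<circ> chart_inv c) (at (snd c p)) (to_coords A c p v)"
  by (intro dir_deriv_chart smooth_function_differentiable)

lemma dir_deriv_cong:
  assumes "p \<in> topspace M" "\<And>q. q \<in> topspace M \<Longrightarrow> f q = f' q"
  shows "dir_deriv A p v f = dir_deriv A p v f'"
proof -
  note c = chart_at[OF assms(1)]
  have "frechet_derivative (f \<circ> chart_inv (chart_at A p)) (at (snd (chart_at A p) p)) =
      frechet_derivative (f' \<circ> chart_inv (chart_at A p)) (at (snd (chart_at A p) p))"
    by (rule frechet_derivative_cong_open[OF open_image_domain[OF c(1)]])
      (use c assms(2) domain_subset[OF c(1)] in \<open>auto simp: inv_into_into\<close>)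
  then show ?thesis by (simp add: dir_deriv_def)
qed

lemma dir_deriv_const: "dir_deriv A p v (\<lambda>q. k) = 0"
  by (simp add: dir_deriv_def o_def)

lemma dir_deriv_cmult:
  assumes "smooth_function A f" "p \<in> topspace M"
  shows "dir_deriv A p v (\<lambda>q. k * f q) = k * dir_deriv A p v f"
proof -
  have "(f \<circ> chart_inv (chart_at A p)) differentiable (at (snd (chart_at A p) p))"
    by (rule smooth_function_differentiable) (use assms chart_at in auto)
  then have "((f \<circ> chart_inv (chart_at A p)) has_derivative
      frechet_derivative (f \<circ> chart_inv (chart_at A p)) (at (snd (chart_at A p) p))) 
      (at (snd (chart_at A p) p))"
    by (simp add: frechet_derivative_works)
  from frechet_derivative_at[OF has_derivative_mult_right[OF this, of k]]
  have "frechet_derivative ((\<lambda>q. k * f q) \<circ> chart_inv (chart_at A p)) (at (snd (chart_at A p) p)) v =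
      k * frechet_derivative (f \<circ> chart_inv (chart_at A p)) (at (snd (chart_at A p) p)) v"
    unfolding o_def by metis
  then show ?thesis by (simp add: dir_deriv_def)
qed

text \<open>
  In a chart the function \<open>Y f\<close> is the derivative of the coordinate expression of \<open>f\<close> along that of
  \<open>Y\<close>. On the left the preferred chart changes with the point, on the right a single chart is used.
\<close>

lemma dir_deriv_field_chart:
  assumes "smooth_function A f" "c \<in> A" "u \<in> snd c ` fst c"
  shows "dir_deriv A (chart_inv c u) (Y (chart_inv c u)) f =
    frechet_derivative (f \<circ> chart_inv c) (at u) (to_coords A c (chart_inv c u) (Y (chart_inv c u)))"
  using assms(3) dir_deriv_smooth[OF assms(1,2)] assms(2) by auto

lemma smooth_function_dir_deriv:
  assumes f: "smooth_function A f" and Y: "smooth_vector_field A Y"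
  shows "smooth_function A (\<lambda>q. dir_deriv A q (Y q) f)"
  unfolding smooth_function_def
proof
  fix c assume c: "c \<in> A"
  have "smooth_on (snd c ` fst c) (\<lambda>u. frechet_derivative (f \<circ> chart_inv c) (at u)
      (to_coords A c (chart_inv c u) (Y (chart_inv c u))))"
    using f Y c by (intro smooth_on_frechet_derivative_along open_image_domain)
      (auto simp: smooth_function_def smooth_vector_field_def Let_def)
  then show "smooth_on (snd c ` fst c) ((\<lambda>q. dir_deriv A q (Y q) f) \<circ> chart_inv c)"
    by (subst smooth_on_cong[OF open_image_domain[OF c]])
      (simp_all add: dir_deriv_field_chart[OF f c])
qed

lemma smooth_function_tensor_02:
  assumes g: "tensor_field_02 M A g" and X: "smooth_vector_field A X" and Y: "smooth_vector_field A Y"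
  shows "smooth_function A (\<lambda>q. g q (X q) (Y q))"
  unfolding smooth_function_def
proof
  fix c assume c: "c \<in> A"
  let ?x = "\<lambda>u. to_coords A c (chart_inv c u) (X (chart_inv c u))"
  let ?y = "\<lambda>u. to_coords A c (chart_inv c u) (Y (chart_inv c u))"
  let ?g = "\<lambda>u v w. g (chart_inv c u) (from_coords A c (chart_inv c u) v) (from_coords A c (chart_inv c u) w)"
  have eq: "g (chart_inv c u) (X (chart_inv c u)) (Y (chart_inv c u)) =
      (\<Sum>i\<in>Basis. \<Sum>j\<in>Basis. ((?x u \<bullet> i) * (?y u \<bullet> j)) * ?g u i j)" if u: "u \<in> snd c ` fst c" for u
  proof -
    obtain p where p: "p \<in> fst c" "u = snd c p" using u by blast
    note pc = domain_subset[OF c p(1)]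
    have bil: "bilinear (g p)" using g pc by (simp add: tensor_field_02_def)
    have "g p (X p) (Y p) = g p (from_coords A c p (to_coords A c p (X p))) (from_coords A c p (to_coords A c p (Y p)))"
      using c p by simp
    also have "\<dots> = g p (\<Sum>i\<in>Basis. (to_coords A c p (X p) \<bullet> i) *\<^sub>R from_coords A c p i)
        (\<Sum>j\<in>Basis. (to_coords A c p (Y p) \<bullet> j) *\<^sub>R from_coords A c p j)"
      using linear_eq_sum_Basis[OF linear_from_coords[OF c p(1)]] by metis
    also have "\<dots> = (\<Sum>(i,j)\<in>Basis\<times>Basis. g p ((to_coords A c p (X p) \<bullet> i) *\<^sub>R from_coords A c p i)
        ((to_coords A c p (Y p) \<bullet> j) *\<^sub>R from_coords A c p j))"
      by (rule bilinear_sum[OF bil])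
    also have "\<dots> = (\<Sum>i\<in>Basis. \<Sum>j\<in>Basis. ((to_coords A c p (X p) \<bullet> i) * (to_coords A c p (Y p) \<bullet> j)) *
        g p (from_coords A c p i) (from_coords A c p j))"
      by (simp add: sum.cartesian_product bilinear_lmul[OF bil] bilinear_rmul[OF bil] mult_ac)
    finally show ?thesis using p c by simp
  qed
  have "smooth_on (snd c ` fst c) (\<lambda>u. \<Sum>i\<in>Basis. \<Sum>j\<in>Basis. ((?x u \<bullet> i) * (?y u \<bullet> j)) * ?g u i j)"
    using g X Y c
    by (intro smooth_on_sum smooth_on_mult open_image_domain
        smooth_on_bounded_linear_compose[OF bounded_linear_inner_left])
      (auto simp: tensor_field_02_def smooth_vector_field_def Let_def)
  then show "smooth_on (snd c ` fst c) ((\<lambda>q. g q (X q) (Y q)) \<circ> chart_inv c)"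
    by (subst smooth_on_cong[OF open_image_domain[OF c]]) (simp_all add: eq)
qed

text \<open>
  Extension by zero is smooth. The set where \<open>F\<close> may be nonzero corresponds to a closed coordinate
  ball of another chart \<open>c\<close>; it is compact, hence closed because the manifold is Hausdorff. So the
  domain of \<open>d\<close> is covered by the overlap with \<open>c\<close> and an open set on which \<open>F\<close> vanishes.
\<close>

lemma smooth_on_chart_if_supported:
  assumes c: "c \<in> A" and d: "d \<in> A" and K: "cball a r \<subseteq> snd c ` fst c"
    and smooth: "smooth_on (snd d ` (fst d \<inter> fst c)) F"
    and zero: "\<And>q. q \<in> fst d \<Longrightarrow> \<not> (q \<in> fst c \<and> snd c q \<in> cball a r) \<Longrightarrow> F (snd d q) = 0"
  shows "smooth_on (snd d ` fst d) F"
proof (rule smooth_on_local)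
  define L where "L = {q \<in> fst c. snd c q \<in> cball a r}"
  have "snd c ` L = cball a r" using K by (auto simp: L_def)
  then have "compactin (top_of_set (snd c ` fst c)) (snd c ` L)"
    using K by (simp add: compactin_subtopology)
  moreover have "L \<subseteq> topspace (subtopology M (fst c))"
    using domain_subset[OF c] by (auto simp: L_def)
  ultimately have "compactin (subtopology M (fst c)) L"
    using homeomorphic_map_compactness[OF homeomorphic_chart[OF c], of L] by simp
  then have "closedin M L"
    using compactin_imp_closedin[OF Hausdorff] by (simp add: compactin_subtopology)
  then have "openin M (fst d - L)" by (intro openin_diff openin_domain d)
  then have open_rest: "open (snd d ` (fst d - L))" by (intro open_image_chart d) auto
  fix u assume "u \<in> snd d ` fst d"
  then obtain q where q: "q \<in> fst d" "u = snd d q" by blast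
  show "\<exists>T. open T \<and> u \<in> T \<and> smooth_on T F"
  proof (cases "q \<in> fst c")
    case True
    then show ?thesis using smooth open_image_overlap[OF d c] q by blast
  next
    case False
    have "smooth_on (snd d ` (fst d - L)) F"
    proof (subst smooth_on_cong[OF open_rest])
      show "F u = 0" if "u \<in> snd d ` (fst d - L)" for u
        using that zero by (auto simp: L_def)
    qed (rule smooth_on_const)
    then show ?thesis using open_rest False q by (auto simp: L_def)
  qed
qed

lemma chart_bump:
  assumes "c \<in> A" "p \<in> fst c"
  obtains b r where "smooth_on UNIV b" "b (snd c p) = (1::real)"
    "cball (snd c p) r \<subseteq> snd c ` fst c" "\<And>x. x \<notin> cball (snd c p) r \<Longrightarrow> b x = 0"
proof -
  obtain r where r: "r > 0" "cball (snd c p) r \<subseteq> snd c ` fst c"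
    using open_image_domain[OF assms(1)] assms(2) open_contains_cball by blast
  with smooth_bump[OF r(1), of "snd c p"] that show thesis by blast
qed

lemma ex_smooth_vector_field:
  assumes p: "p \<in> topspace M"
  shows "\<exists>X. smooth_vector_field A X \<and> X p = v"
proof -
  define c where "c = chart_at A p"
  have c: "c \<in> A" "p \<in> fst c" using chart_at[OF p] by (auto simp: c_def)
  obtain b r where b: "smooth_on UNIV b" "b (snd c p) = (1::real)"
    "cball (snd c p) r \<subseteq> snd c ` fst c" "\<And>x. x \<notin> cball (snd c p) r \<Longrightarrow> b x = 0"
    using chart_bump[OF c] by metis
  define w where "w = to_coords A c p v"
  \<comment> \<open>The coordinate field with constant components \<open>w\<close> in the chart \<open>c\<close>, cut off by \<open>b\<close>.\<close>
  define X where "X q = (if q \<in> fst c then b (snd c q) *\<^sub>R from_coords A c q w else 0)" for q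
  have "smooth_on (snd d ` fst d) (\<lambda>u. to_coords A d (chart_inv d u) (X (chart_inv d u)))" if d: "d \<in> A" for d
  proof (rule smooth_on_chart_if_supported[OF c(1) d b(3)])
    let ?S = "snd d ` (fst d \<inter> fst c)"
    let ?t = "snd c \<circ> chart_inv d"
    have t: "smooth_on ?S ?t" by (rule smooth_transition[OF d c(1)])
    have S: "open ?S" by (rule open_image_overlap[OF d c(1)])
    have tS: "?t ` ?S \<subseteq> snd c ` (fst c \<inter> fst d)" using d by auto
    have "smooth_on ?S (\<lambda>u. b (?t u) *\<^sub>R frechet_derivative (snd d \<circ> chart_inv c) (at (?t u)) w)"
      by (intro smooth_on_scaleR S smooth_on_compose[OF S t b(1)]
          smooth_on_compose[OF S t smooth_on_frechet_derivative[OF smooth_transition[OF c(1) d]] tS]) auto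
    then show "smooth_on ?S (\<lambda>u. to_coords A d (chart_inv d u) (X (chart_inv d u)))"
      by (subst smooth_on_cong[OF S])
        (use c d in \<open>auto simp: X_def linear_scale[OF linear_to_coords] to_coords_from_coords jacobian_def\<close>)
    fix q assume "q \<in> fst d" "\<not> (q \<in> fst c \<and> snd c q \<in> cball (snd c p) r)"
    then show "to_coords A d (chart_inv d (snd d q)) (X (chart_inv d (snd d q))) = 0"
      using b(4) d by (auto simp: X_def linear_0[OF linear_to_coords])
  qed
  then have "smooth_vector_field A X" by (simp add: smooth_vector_field_def Let_def)
  moreover have "X p = v" using c b(2) by (simp add: X_def w_def)
  ultimately show ?thesis by blast
qed

text \<open>
  The function is \<open>L\<close> in coordinates centred at \<open>p\<close>, cut off by a bump function \<open>b\<close>. Since \<open>L\<close>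
  then vanishes at \<open>p\<close>, the derivative of \<open>b\<close> does not contribute to the differential there.
\<close>

lemma ex_smooth_function_with_differential:
  assumes c: "c \<in> A" "p \<in> fst c" and L: "linear L"
  shows "\<exists>f. smooth_function A f \<and> (\<forall>v. dir_deriv A p v f = L (to_coords A c p v))"
proof -
  obtain b r where b: "smooth_on UNIV b" "b (snd c p) = (1::real)"
    "cball (snd c p) r \<subseteq> snd c ` fst c" "\<And>x. x \<notin> cball (snd c p) r \<Longrightarrow> b x = 0"
    using chart_bump[OF c] by metis
  define F where "F u = b u * (L u + - L (snd c p))" for u
  define f where "f q = (if q \<in> fst c then F (snd c q) else 0)" for q
  have F: "smooth_on UNIV F"
    unfolding F_def by (intro smooth_on_mult smooth_on_add smooth_on_const smooth_on_linear b L open_UNIV)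
  have sf: "smooth_function A f"
    unfolding smooth_function_def
  proof
    fix d assume d: "d \<in> A"
    show "smooth_on (snd d ` fst d) (f \<circ> chart_inv d)"
    proof (rule smooth_on_chart_if_supported[OF c(1) d b(3)])
      let ?S = "snd d ` (fst d \<inter> fst c)"
      have S: "open ?S" by (rule open_image_overlap[OF d c(1)])
      have "smooth_on ?S (\<lambda>u. F ((snd c \<circ> chart_inv d) u))"
        by (rule smooth_on_compose[OF S smooth_transition[OF d c(1)] F]) auto
      then show "smooth_on ?S (f \<circ> chart_inv d)"
        by (subst smooth_on_cong[OF S]) (use d in \<open>auto simp: f_def\<close>)
      fix q assume "q \<in> fst d" "\<not> (q \<in> fst c \<and> snd c q \<in> cball (snd c p) r)"
      then show "(f \<circ> chart_inv d) (snd d q) = 0"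
        using b(4) d by (auto simp: f_def F_def)
    qed
  qed
  have db: "(b has_derivative frechet_derivative b (at (snd c p))) (at (snd c p))"
    by (rule smooth_on_has_derivative[OF b(1)]) simp
  have dL: "(L has_derivative L) (at (snd c p))"
    using L by (simp add: bounded_linear_imp_has_derivative linear_conv_bounded_linear)
  have "((\<lambda>u. b u * (L u + - L (snd c p))) has_derivative L) (at (snd c p))"
    using has_derivative_mult[OF db has_derivative_add[OF dL has_derivative_const[of "- L (snd c p)"]]] b(2)
    by simp
  then have "(F has_derivative L) (at (snd c p))" by (simp add: F_def[abs_def])
  then have "((f \<circ> chart_inv c) has_derivative L) (at (snd c p))"
    by (rule has_derivative_transform_within_open[OF _ open_image_domain[OF c(1)]])
      (use c in \<open>auto simp: f_def\<close>)
  from frechet_derivative_at[OF this]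
  have "\<forall>v. dir_deriv A p v f = L (to_coords A c p v)"
    using dir_deriv_smooth[OF sf c] by metis
  with sf show ?thesis by blast
qed

lemma tangent_vector_eqI:
  assumes p: "p \<in> topspace M"
    and eq: "\<And>f. smooth_function A f \<Longrightarrow> dir_deriv A p v f = dir_deriv A p w f"
  shows "v = w"
proof -
  define c where "c = chart_at A p"
  have c: "c \<in> A" "p \<in> fst c" using chart_at[OF p] by (auto simp: c_def)
  have "to_coords A c p v \<bullet> i = to_coords A c p w \<bullet> i" for i
    using ex_smooth_function_with_differential[OF c, of "\<lambda>x. x \<bullet> i"] eq
    by (metis bounded_linear.linear bounded_linear_inner_left)
  then have "to_coords A c p v = to_coords A c p w"
    by (metis vector_eq_rdot)
  then show ?thesis using from_coords_to_coords[OF c] by metis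
qed

text \<open>
  The commutator of \<open>X\<close> and \<open>Y\<close> acts on functions as a tangent vector, because the terms with second
  derivatives of the function cancel. In a chart with components \<open>x\<close>, \<open>y\<close> this vector is
  \<open>Dy x - Dx y\<close>; it is the only such vector by \<open>tangent_vector_eqI\<close>.
\<close>

lemma dir_deriv_lie_bracket:
  assumes X: "smooth_vector_field A X" and Y: "smooth_vector_field A Y" and p: "p \<in> topspace M"
    and f: "smooth_function A f"
  shows "dir_deriv A p (lie_bracket A X Y p) f =
    dir_deriv A p (X p) (\<lambda>q. dir_deriv A q (Y q) f) - dir_deriv A p (Y p) (\<lambda>q. dir_deriv A q (X q) f)"
proof -
  let ?br = "\<lambda>v. \<forall>f. smooth_function A f \<longrightarrow> dir_deriv A p v f =
    dir_deriv A p (X p) (\<lambda>q. dir_deriv A q (Y q) f) - dir_deriv A p (Y p) (\<lambda>q. dir_deriv A q (X q) f)"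
  define c where "c = chart_at A p"
  have c: "c \<in> A" "p \<in> fst c" using chart_at[OF p] by (auto simp: c_def)
  let ?S = "snd c ` fst c"
  define a where "a = snd c p"
  have S: "open ?S" "a \<in> ?S" using open_image_domain[OF c(1)] c by (auto simp: a_def)
  have inv_a: "chart_inv c a = p" using c by (simp add: a_def)
  define x where "x u = to_coords A c (chart_inv c u) (X (chart_inv c u))" for u
  define y where "y u = to_coords A c (chart_inv c u) (Y (chart_inv c u))" for u
  have second: "dir_deriv A p (X p) (\<lambda>q. dir_deriv A q (Y q) f) =
      frechet_derivative (f \<circ> chart_inv c) (at a) (frechet_derivative y (at a) (x a)) +
      frechet_derivative (\<lambda>u. frechet_derivative (f \<circ> chart_inv c) (at u) (y a)) (at a) (x a)"
    if f: "smooth_function A f" and X: "smooth_vector_field A X" and Y: "smooth_vector_field A Y"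
      and x: "\<And>u. x u = to_coords A c (chart_inv c u) (X (chart_inv c u))"
      and y: "\<And>u. y u = to_coords A c (chart_inv c u) (Y (chart_inv c u))" for f X Y x y
  proof -
    have ys: "smooth_on ?S y"
      using Y c by (simp add: y[abs_def] smooth_vector_field_def Let_def)
    have fs: "smooth_on ?S (f \<circ> chart_inv c)" using f c by (simp add: smooth_function_def)
    have "dir_deriv A p (X p) (\<lambda>q. dir_deriv A q (Y q) f) =
        frechet_derivative ((\<lambda>q. dir_deriv A q (Y q) f) \<circ> chart_inv c) (at a) (x a)"
      using dir_deriv_smooth[OF smooth_function_dir_deriv[OF f Y] c] by (simp add: x inv_a a_def[symmetric])
    also have "\<dots> = frechet_derivative (\<lambda>u. frechet_derivative (f \<circ> chart_inv c) (at u) (y u)) (at a) (x a)"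
      by (subst frechet_derivative_cong_open[OF S]) (auto simp only: o_apply y dir_deriv_field_chart[OF f c(1)])
    also have "\<dots> = frechet_derivative (f \<circ> chart_inv c) (at a) (frechet_derivative y (at a) (x a)) +
      frechet_derivative (\<lambda>u. frechet_derivative (f \<circ> chart_inv c) (at u) (y a)) (at a) (x a)"
      by (rule frechet_derivative_along[OF S(1) fs ys S(2)])
    finally show ?thesis .
  qed
  define v where "v = from_coords A c p (frechet_derivative y (at a) (x a) - frechet_derivative x (at a) (y a))"
  have v: "?br v"
  proof (intro allI impI)
    fix f assume f: "smooth_function A f"
    have fs: "smooth_on ?S (f \<circ> chart_inv c)" using f c by (simp add: smooth_function_def)
    have lin: "linear (frechet_derivative (f \<circ> chart_inv c) (at a))"
      by (rule has_derivative_linear[OF smooth_on_has_derivative[OF fs S(2)]])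
    have "dir_deriv A p v f = frechet_derivative (f \<circ> chart_inv c) (at a)
        (frechet_derivative y (at a) (x a) - frechet_derivative x (at a) (y a))"
      using dir_deriv_smooth[OF f c, of v] c by (simp add: v_def a_def)
    then show "dir_deriv A p v f = dir_deriv A p (X p) (\<lambda>q. dir_deriv A q (Y q) f) -
        dir_deriv A p (Y p) (\<lambda>q. dir_deriv A q (X q) f)"
      using second[OF f X Y x_def y_def] second[OF f Y X y_def x_def]
        symmetric_second_derivative[OF S(1) fs S(2), of "x a" "y a"]
      by (simp add: linear_diff[OF lin])
  qed
  have "?br (THE v. ?br v)"
    by (rule theI[of ?br, OF v]) (use v in \<open>auto intro!: tangent_vector_eqI[OF p]\<close>)
  then show ?thesis using f unfolding lie_bracket_def by blast
qed

lemma extend_vector: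
  assumes "p \<in> topspace M"
  shows "smooth_vector_field A (extend_vector A p v)" and "extend_vector A p v p = v"
  using someI_ex[OF ex_smooth_vector_field[OF assms, of v]] by (auto simp: extend_vector_def)

end

lemma trace_matrix: "trace (matrix f) = (\<Sum>i\<in>UNIV. f (axis i 1) $ i)"
  by (simp add: trace_def matrix_def)

section \<open>Connections and curvature\<close>

locale manifold_with_connection = manifold M A
  for M :: "'a topology" and A :: "('a, 'n::finite) chart set" +
  fixes D :: "('a \<Rightarrow> real ^ 'n) \<Rightarrow> ('a \<Rightarrow> real ^ 'n) \<Rightarrow> 'a \<Rightarrow> real ^ 'n"
  assumes connection: "affine_connection M A D"
begin

lemma smooth_D:
  "smooth_vector_field A X \<Longrightarrow> smooth_vector_field A Y \<Longrightarrow> smooth_vector_field A (D X Y)"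
  using connection by (simp add: affine_connection_def)

lemma D_add_left:
  "smooth_vector_field A X \<Longrightarrow> smooth_vector_field A X' \<Longrightarrow> smooth_vector_field A Y \<Longrightarrow>
    p \<in> topspace M \<Longrightarrow> D (\<lambda>q. X q + X' q) Y p = D X Y p + D X' Y p"
  using connection by (simp add: affine_connection_def)

lemma D_scale_left:
  "smooth_function A f \<Longrightarrow> smooth_vector_field A X \<Longrightarrow> smooth_vector_field A Y \<Longrightarrow>
    p \<in> topspace M \<Longrightarrow> D (\<lambda>q. f q *\<^sub>R X q) Y p = f p *\<^sub>R D X Y p"
  using connection by (simp add: affine_connection_def)

lemma D_add_right:
  "smooth_vector_field A X \<Longrightarrow> smooth_vector_field A Y \<Longrightarrow> smooth_vector_field A Y' \<Longrightarrow>
    p \<in> topspace M \<Longrightarrow> D X (\<lambda>q. Y q + Y' q) p = D X Y p + D X Y' p"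
  using connection by (simp add: affine_connection_def)

lemma D_scale_right:
  "smooth_function A f \<Longrightarrow> smooth_vector_field A X \<Longrightarrow> smooth_vector_field A Y \<Longrightarrow>
    p \<in> topspace M \<Longrightarrow> D X (\<lambda>q. f q *\<^sub>R Y q) p = dir_deriv A p (X p) f *\<^sub>R Y p + f p *\<^sub>R D X Y p"
  using connection by (simp add: affine_connection_def)

lemma D_cmult_right:
  "smooth_vector_field A X \<Longrightarrow> smooth_vector_field A Y \<Longrightarrow>
    p \<in> topspace M \<Longrightarrow> D X (\<lambda>q. k *\<^sub>R Y q) p = k *\<^sub>R D X Y p"
  using D_scale_right[OF smooth_function_const, of X Y p k] by (simp add: dir_deriv_const)

lemma smooth_vector_field_vanishing:
  assumes "\<And>q. q \<in> topspace M \<Longrightarrow> W q = 0"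
  shows "smooth_vector_field A W"
  unfolding smooth_vector_field_def
proof
  fix c assume c: "c \<in> A"
  show "smooth_on (snd c ` fst c) (\<lambda>u. let p = chart_inv c u in to_coords A c p (W p))"
    by (subst smooth_on_chart_cong[OF c, where G = "\<lambda>u. 0"])
      (simp_all add: c assms domain_subset[OF c] linear_0[OF linear_to_coords] smooth_on_const)
qed

text \<open>
  Vector fields are total functions, and \<open>D\<close> could in principle look at their values off the
  manifold. It cannot do so by linearity over functions: multiplying by the function that is 0 on the
  manifold and 1 elsewhere does not change a field \<open>W\<close> that vanishes on the manifold, but it
  annihilates its covariant derivative.
\<close>

lemma D_vanishing:
  assumes W: "\<And>q. q \<in> topspace M \<Longrightarrow> W q = 0" and Y: "smooth_vector_field A Y" and p: "p \<in> topspace M"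
  shows "D W Y p = 0" and "D Y W p = 0"
proof -
  define f :: "'a \<Rightarrow> real" where "f q = (if q \<in> topspace M then 0 else 1)" for q
  have f: "smooth_function A f"
    using smooth_function_cong[of f "\<lambda>q. 0"] smooth_function_const by (simp add: f_def)
  have sW: "smooth_vector_field A W" using W by (rule smooth_vector_field_vanishing)
  have fW: "(\<lambda>q. f q *\<^sub>R W q) = W" using W by (auto simp: f_def)
  show "D W Y p = 0"
    using D_scale_left[OF f sW Y p] p unfolding fW by (simp add: f_def)
  show "D Y W p = 0"
    using D_scale_right[OF f Y sW p] p W unfolding fW by (simp add: f_def)
qed

lemma D_cong:
  assumes X: "smooth_vector_field A X" and Y: "smooth_vector_field A Y" and p: "p \<in> topspace M"
    and XX: "\<And>q. q \<in> topspace M \<Longrightarrow> X q = X' q"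
    and YY: "\<And>q. q \<in> topspace M \<Longrightarrow> Y q = Y' q"
  shows "D X Y p = D X' Y' p"
proof -
  have X': "smooth_vector_field A X'" using X smooth_vector_field_cong[of X X'] XX by blast
  have Y': "smooth_vector_field A Y'" using Y smooth_vector_field_cong[of Y Y'] YY by blast
  have "D X' Y' p = D (\<lambda>q. X q + (X' q - X q)) Y' p" by simp
  also have "\<dots> = D X Y' p"
    by (subst D_add_left) (use X X' Y' p XX in \<open>simp_all add: smooth_vector_field_diff D_vanishing\<close>)
  also have "\<dots> = D X (\<lambda>q. Y q + (Y' q - Y q)) p" by simp
  also have "\<dots> = D X Y p"
    by (subst D_add_right) (use X Y Y' p YY in \<open>simp_all add: smooth_vector_field_diff D_vanishing\<close>)
  finally show ?thesis by simp
qed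

end

locale manifold_with_torsion_free_connection = manifold_with_connection M A D
  for M :: "'a topology" and A :: "('a, 'n::finite) chart set" and D +
  assumes torsion_free: "smooth_vector_field A X \<Longrightarrow> smooth_vector_field A Y \<Longrightarrow> p \<in> topspace M \<Longrightarrow>
    D X Y p - D Y X p = lie_bracket A X Y p"
begin

text \<open>
  On the manifold \<open>[X, Y] = D\<^sub>X Y - D\<^sub>Y X\<close>, and the connection preserves smoothness.
\<close>

lemma smooth_lie_bracket:
  assumes "smooth_vector_field A X" "smooth_vector_field A Y"
  shows "smooth_vector_field A (lie_bracket A X Y)"
  using smooth_vector_field_diff[OF smooth_D[OF assms] smooth_D[OF assms(2,1)]]
    smooth_vector_field_cong[of "\<lambda>p. D X Y p - D Y X p" "lie_bracket A X Y"] torsion_free[OF assms]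
  by blast

lemma curvature_cong:
  assumes X: "smooth_vector_field A X" and Y: "smooth_vector_field A Y" and Z: "smooth_vector_field A Z"
    and p: "p \<in> topspace M" and ZZ: "\<And>q. q \<in> topspace M \<Longrightarrow> Z q = Z' q"
  shows "curvature A D X Y Z p = curvature A D X Y Z' p"
  unfolding curvature_def
  using D_cong[OF X smooth_D[OF Y Z] p refl D_cong[OF Y Z _ refl ZZ]]
    D_cong[OF Y smooth_D[OF X Z] p refl D_cong[OF X Z _ refl ZZ]]
    D_cong[OF smooth_lie_bracket[OF X Y] Z p refl ZZ]
  by simp

lemma curvature_add:
  assumes X: "smooth_vector_field A X" and Y: "smooth_vector_field A Y"
    and Z: "smooth_vector_field A Z" and V: "smooth_vector_field A V" and p: "p \<in> topspace M"
  shows "curvature A D X Y (\<lambda>q. Z q + V q) p = curvature A D X Y Z p + curvature A D X Y V p"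
proof -
  have two: "D X (D Y (\<lambda>q. Z q + V q)) p = D X (D Y Z) p + D X (D Y V) p"
    if X: "smooth_vector_field A X" and Y: "smooth_vector_field A Y" for X Y
  proof -
    have "D X (D Y (\<lambda>q. Z q + V q)) p = D X (\<lambda>q. D Y Z q + D Y V q) p"
      by (intro D_cong smooth_D smooth_vector_field_add X Y Z V p refl D_add_right)
    then show ?thesis using D_add_right[OF X smooth_D[OF Y Z] smooth_D[OF Y V] p] by simp
  qed
  show ?thesis
    unfolding curvature_def two[OF X Y] two[OF Y X] D_add_right[OF smooth_lie_bracket[OF X Y] Z V p]
    by simp
qed

text \<open>
  The Leibniz rule produces the terms \<open>X(Yf) Z - Y(Xf) Z - ([X, Y]f) Z\<close>, which cancel, and first order
  terms that are symmetric in \<open>X\<close> and \<open>Y\<close>.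
\<close>

lemma curvature_scale:
  assumes X: "smooth_vector_field A X" and Y: "smooth_vector_field A Y"
    and Z: "smooth_vector_field A Z" and f: "smooth_function A f" and p: "p \<in> topspace M"
  shows "curvature A D X Y (\<lambda>q. f q *\<^sub>R Z q) p = f p *\<^sub>R curvature A D X Y Z p"
proof -
  have two: "D X (D Y (\<lambda>q. f q *\<^sub>R Z q)) p =
      dir_deriv A p (X p) (\<lambda>q. dir_deriv A q (Y q) f) *\<^sub>R Z p + dir_deriv A p (Y p) f *\<^sub>R D X Z p +
      (dir_deriv A p (X p) f *\<^sub>R D Y Z p + f p *\<^sub>R D X (D Y Z) p)"
    if X: "smooth_vector_field A X" and Y: "smooth_vector_field A Y" for X Y
  proof -
    have Yf: "smooth_function A (\<lambda>q. dir_deriv A q (Y q) f)" by (rule smooth_function_dir_deriv[OF f Y])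
    have YZ: "smooth_vector_field A (D Y Z)" by (rule smooth_D[OF Y Z])
    have "D X (D Y (\<lambda>q. f q *\<^sub>R Z q)) p = D X (\<lambda>q. dir_deriv A q (Y q) f *\<^sub>R Z q + f q *\<^sub>R D Y Z q) p"
      by (intro D_cong smooth_D smooth_vector_field_scale X Y Z f p refl D_scale_right)
    also have "\<dots> = D X (\<lambda>q. dir_deriv A q (Y q) f *\<^sub>R Z q) p + D X (\<lambda>q. f q *\<^sub>R D Y Z q) p"
      by (intro D_add_right X smooth_vector_field_scale Yf f YZ Z p)
    finally show ?thesis
      unfolding D_scale_right[OF Yf X Z p] D_scale_right[OF f X YZ p] .
  qed
  show ?thesis
    unfolding curvature_def two[OF X Y] two[OF Y X] D_scale_right[OF f smooth_lie_bracket[OF X Y] Z p]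
      dir_deriv_lie_bracket[OF X Y p f]
    by (simp add: algebra_simps)
qed

lemma ricci_sum:
  "ricci A D Y Z p = (\<Sum>i\<in>UNIV. curvature A D (extend_vector A p (axis i 1)) Y Z p $ i)"
  by (simp add: ricci_def trace_matrix)

lemma ricci_cong:
  assumes "smooth_vector_field A Y" "smooth_vector_field A Z" "p \<in> topspace M"
    "\<And>q. q \<in> topspace M \<Longrightarrow> Z q = Z' q"
  shows "ricci A D Y Z p = ricci A D Y Z' p"
  unfolding ricci_sum using curvature_cong[OF extend_vector(1)[OF assms(3)] assms] by simp

lemma ricci_add:
  assumes "smooth_vector_field A Y" "smooth_vector_field A Z" "smooth_vector_field A V" "p \<in> topspace M"
  shows "ricci A D Y (\<lambda>q. Z q + V q) p = ricci A D Y Z p + ricci A D Y V p"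
  unfolding ricci_sum using curvature_add[OF extend_vector(1)[OF assms(4)] assms]
  by (simp add: sum.distrib)

lemma ricci_scale:
  assumes "smooth_vector_field A Y" "smooth_vector_field A Z" "smooth_function A f" "p \<in> topspace M"
  shows "ricci A D Y (\<lambda>q. f q *\<^sub>R Z q) p = f p * ricci A D Y Z p"
  unfolding ricci_sum using curvature_scale[OF extend_vector(1)[OF assms(4)] assms]
  by (simp add: sum_distrib_left)

end

section \<open>Para Sasakian manifolds\<close>

locale para_sasakian =
  fixes M :: "'a topology" and A :: "('a, 'n::finite) chart set"
    and \<phi> :: "'a \<Rightarrow> real ^ 'n \<Rightarrow> real ^ 'n" and \<xi> :: "'a \<Rightarrow> real ^ 'n"
    and \<eta> :: "'a \<Rightarrow> real ^ 'n \<Rightarrow> real" and g :: "'a \<Rightarrow> real ^ 'n \<Rightarrow> real ^ 'n \<Rightarrow> real"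
    and \<epsilon> :: real and D :: "('a \<Rightarrow> real ^ 'n) \<Rightarrow> ('a \<Rightarrow> real ^ 'n) \<Rightarrow> 'a \<Rightarrow> real ^ 'n"
  assumes para_sasakian: "eps_para_sasakian M A \<phi> \<xi> \<eta> g \<epsilon> D"
begin

sublocale manifold_with_torsion_free_connection M A D
  using para_sasakian
  by unfold_locales (auto simp: eps_para_sasakian_def levi_civita_connection_def)

lemma almost_paracontact: "eps_almost_paracontact_metric M A \<phi> \<xi> \<eta> g \<epsilon>"
  using para_sasakian by (simp add: eps_para_sasakian_def)

lemma eps_squared [simp]: "\<epsilon> * \<epsilon> = 1" "\<epsilon> * (\<epsilon> * k) = k"
  using almost_paracontact by (auto simp: eps_almost_paracontact_metric_def)

lemma smooth_xi: "smooth_vector_field A \<xi>"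
  using almost_paracontact by (simp add: eps_almost_paracontact_metric_def)

lemma tensor_metric: "tensor_field_02 M A g"
  using almost_paracontact by (simp add: eps_almost_paracontact_metric_def pseudo_riemannian_metric_def)

context
  fixes p assumes p: "p \<in> topspace M"
begin

lemma linear_phi: "linear (\<phi> p)"
  using almost_paracontact p by (simp add: eps_almost_paracontact_metric_def tensor_field_11_def)

lemma linear_eta: "linear (\<eta> p)"
  using almost_paracontact p by (simp add: eps_almost_paracontact_metric_def one_form_def)

lemma bilinear_metric: "bilinear (g p)"
  using tensor_metric p by (simp add: tensor_field_02_def)

lemma metric_sym: "g p v w = g p w v"
  using almost_paracontact p by (simp add: eps_almost_paracontact_metric_def pseudo_riemannian_metric_def)

lemma phi_phi: "\<phi> p (\<phi> p v) = v - \<eta> p v *\<^sub>R \<xi> p"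
  and eta_xi: "\<eta> p (\<xi> p) = 1"
  and phi_xi: "\<phi> p (\<xi> p) = 0"
  and eta_phi: "\<eta> p (\<phi> p v) = 0"
  and metric_phi_phi: "g p (\<phi> p v) (\<phi> p w) = g p v w - \<epsilon> * \<eta> p v * \<eta> p w"
  using almost_paracontact p by (auto simp: eps_almost_paracontact_metric_def)

lemma eta_metric: "\<eta> p v = \<epsilon> * g p v (\<xi> p)"
proof -
  have "0 = g p v (\<xi> p) - \<epsilon> * \<eta> p v"
    using metric_phi_phi[of v "\<xi> p"] by (simp add: phi_xi eta_xi bilinear_rzero[OF bilinear_metric])
  then have "\<epsilon> * g p v (\<xi> p) = \<epsilon> * (\<epsilon> * \<eta> p v)" by simp
  then show ?thesis by simp
qed

lemma metric_xi: "g p v (\<xi> p) = \<epsilon> * \<eta> p v"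
  by (simp add: eta_metric)

lemma metric_phi_sym: "g p (\<phi> p v) w = g p v (\<phi> p w)"
  using metric_phi_phi[of v "\<phi> p w"]
  by (simp add: phi_phi eta_phi bilinear_rsub[OF bilinear_metric] bilinear_rmul[OF bilinear_metric] metric_xi)

lemma covariant_phi:
  assumes "smooth_vector_field A X" "smooth_vector_field A Y"
  shows "D X (\<lambda>q. \<phi> q (Y q)) p - \<phi> p (D X Y p) =
    - (g p (\<phi> p (X p)) (\<phi> p (Y p)) *\<^sub>R \<xi> p) - (\<epsilon> * \<eta> p (Y p)) *\<^sub>R \<phi> p (\<phi> p (X p))"
  using para_sasakian assms p by (simp add: eps_para_sasakian_def)

lemma metric_compatible:
  assumes "smooth_vector_field A X" "smooth_vector_field A Y" "smooth_vector_field A Z"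
  shows "dir_deriv A p (X p) (\<lambda>q. g q (Y q) (Z q)) = g p (D X Y p) (Z p) + g p (Y p) (D X Z p)"
  using para_sasakian assms p by (simp add: eps_para_sasakian_def levi_civita_connection_def)

end

lemma smooth_eta: "smooth_vector_field A Y \<Longrightarrow> smooth_function A (\<lambda>q. \<eta> q (Y q))"
  using smooth_function_mult[OF smooth_function_const smooth_function_tensor_02[OF tensor_metric _ smooth_xi]]
    smooth_function_cong[of "\<lambda>q. \<eta> q (Y q)" "\<lambda>q. \<epsilon> * g q (Y q) (\<xi> q)"] eta_metric by blast

text \<open>
  The formula for \<open>\<nabla>\<phi>\<close> with \<open>Y = \<xi>\<close> determines \<open>\<phi>(\<nabla>\<^sub>X\<xi>)\<close>. Applying \<open>\<phi>\<close> once more recovers \<open>\<nabla>\<^sub>X\<xi>\<close>, because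
  its \<open>\<xi>\<close>-component vanishes: \<open>g(\<xi>, \<xi>) = \<epsilon>\<close> is constant.
\<close>

lemma D_xi:
  assumes X: "smooth_vector_field A X" and p: "p \<in> topspace M"
  shows "D X \<xi> p = \<epsilon> *\<^sub>R \<phi> p (X p)"
proof -
  have "D X (\<lambda>q. \<phi> q (\<xi> q)) p = 0"
    using D_vanishing(2)[OF _ X p] phi_xi by simp
  then have 1: "\<phi> p (D X \<xi> p) = \<epsilon> *\<^sub>R \<phi> p (\<phi> p (X p))"
    using covariant_phi[OF p X smooth_xi]
    by (simp add: phi_xi[OF p] eta_xi[OF p] bilinear_rzero[OF bilinear_metric[OF p]])
  have "dir_deriv A p (X p) (\<lambda>q. g q (\<xi> q) (\<xi> q)) = dir_deriv A p (X p) (\<lambda>q. \<epsilon>)"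
    by (rule dir_deriv_cong[OF p]) (simp add: metric_xi eta_xi)
  then have "g p (D X \<xi> p) (\<xi> p) = 0"
    using metric_compatible[OF p X smooth_xi smooth_xi] metric_sym[OF p, of "\<xi> p"]
    by (simp add: dir_deriv_const)
  then have 2: "\<eta> p (D X \<xi> p) = 0" by (simp add: eta_metric[OF p])
  have "D X \<xi> p = \<phi> p (\<phi> p (D X \<xi> p))" by (simp add: phi_phi[OF p] 2)
  also have "\<dots> = \<epsilon> *\<^sub>R \<phi> p (\<phi> p (\<phi> p (X p)))"
    by (simp only: 1 linear_scale[OF linear_phi[OF p]])
  also have "\<dots> = \<epsilon> *\<^sub>R \<phi> p (X p)" by (simp add: phi_phi[OF p, of "\<phi> p (X p)"] eta_phi[OF p])
  finally show ?thesis .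
qed

text \<open>
  On the manifold \<open>\<phi>X = \<epsilon> \<nabla>\<^sub>X\<xi>\<close>, and covariant derivatives of smooth fields are smooth.
\<close>

lemma smooth_phi:
  assumes "smooth_vector_field A X"
  shows "smooth_vector_field A (\<lambda>q. \<phi> q (X q))"
proof -
  have "smooth_vector_field A (\<lambda>q. \<epsilon> *\<^sub>R D X \<xi> q)"
    by (intro smooth_vector_field_cmult smooth_D assms smooth_xi)
  then show ?thesis
    by (subst smooth_vector_field_cong[where Y = "\<lambda>q. \<epsilon> *\<^sub>R D X \<xi> q"]) (simp_all add: D_xi[OF assms])
qed

text \<open>
  As \<open>\<nabla>\<close> is metric and torsion-free, \<open>L\<^sub>\<xi>g(X, Y) = g(\<nabla>\<^sub>X\<xi>, Y) + g(X, \<nabla>\<^sub>Y\<xi>)\<close>; both summands are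
  \<open>\<epsilon> g(\<phi>X, Y)\<close> because \<open>\<phi>\<close> is self-adjoint.
\<close>

lemma half_lie_derivative_metric:
  assumes X: "smooth_vector_field A X" and Y: "smooth_vector_field A Y" and p: "p \<in> topspace M"
  shows "1/2 * lie_derivative_metric A \<xi> g X Y p = \<epsilon> * g p (\<phi> p (X p)) (Y p)"
proof -
  note bil = bilinear_metric[OF p]
  have "lie_bracket A \<xi> X p = D \<xi> X p - \<epsilon> *\<^sub>R \<phi> p (X p)"
    "lie_bracket A \<xi> Y p = D \<xi> Y p - \<epsilon> *\<^sub>R \<phi> p (Y p)"
    using torsion_free[OF smooth_xi _ p] X Y D_xi[OF _ p] by metis+
  then show ?thesis
    unfolding lie_derivative_metric_def
    by (simp add: metric_compatible[OF p smooth_xi X Y] bilinear_lsub[OF bil] bilinear_rsub[OF bil]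
        bilinear_lmul[OF bil] bilinear_rmul[OF bil] metric_phi_sym[OF p])
qed

text \<open>
  Since \<open>\<nabla>\<xi> = \<epsilon>\<phi>\<close>, the curvature on \<open>\<xi>\<close> is \<open>\<epsilon>\<close> times the skew-symmetrisation of \<open>(\<nabla>\<^sub>X\<phi>)Y\<close>, whose
  \<open>g(\<phi>X, \<phi>Y)\<xi>\<close> part is symmetric and drops out.
\<close>

lemma curvature_xi:
  assumes X: "smooth_vector_field A X" and Y: "smooth_vector_field A Y" and p: "p \<in> topspace M"
  shows "curvature A D X Y \<xi> p = \<eta> p (X p) *\<^sub>R Y p - \<eta> p (Y p) *\<^sub>R X p"
proof -
  have two: "D X (D Y \<xi>) p = \<epsilon> *\<^sub>R \<phi> p (D X Y p) - \<epsilon> *\<^sub>R (g p (\<phi> p (X p)) (\<phi> p (Y p)) *\<^sub>R \<xi> p)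
      - \<eta> p (Y p) *\<^sub>R (X p - \<eta> p (X p) *\<^sub>R \<xi> p)"
    if X: "smooth_vector_field A X" and Y: "smooth_vector_field A Y" for X Y
  proof -
    have "D X (D Y \<xi>) p = D X (\<lambda>q. \<epsilon> *\<^sub>R \<phi> q (Y q)) p"
      by (intro D_cong smooth_D X Y p smooth_xi refl D_xi)
    also have "\<dots> = \<epsilon> *\<^sub>R D X (\<lambda>q. \<phi> q (Y q)) p"
      by (rule D_cmult_right[OF X smooth_phi[OF Y] p])
    also have "D X (\<lambda>q. \<phi> q (Y q)) p = \<phi> p (D X Y p) - (g p (\<phi> p (X p)) (\<phi> p (Y p)) *\<^sub>R \<xi> p)
      - (\<epsilon> * \<eta> p (Y p)) *\<^sub>R \<phi> p (\<phi> p (X p))"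
      using covariant_phi[OF p X Y] by (simp add: algebra_simps)
    finally show ?thesis by (simp add: phi_phi[OF p] scaleR_diff_right)
  qed
  have br: "D (lie_bracket A X Y) \<xi> p = \<epsilon> *\<^sub>R \<phi> p (D X Y p) - \<epsilon> *\<^sub>R \<phi> p (D Y X p)"
    unfolding D_xi[OF smooth_lie_bracket[OF X Y] p] torsion_free[OF X Y p, symmetric]
    by (simp add: linear_diff[OF linear_phi[OF p]] scaleR_diff_right)
  have "g p (\<phi> p (X p)) (\<phi> p (Y p)) = g p (\<phi> p (Y p)) (\<phi> p (X p))" by (rule metric_sym[OF p])
  then show ?thesis
    unfolding curvature_def two[OF X Y] two[OF Y X] br by (simp add: algebra_simps)
qed

lemma ricci_xi:
  assumes Y: "smooth_vector_field A Y" and p: "p \<in> topspace M"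
  shows "ricci A D Y \<xi> p = (1 - real CARD('n)) * \<eta> p (Y p)"
proof -
  have "\<eta> p (Y p) = \<eta> p (\<Sum>i\<in>UNIV. (Y p $ i) *\<^sub>R axis i 1)"
    using basis_expansion[of "Y p"] by (simp add: scalar_mult_eq_scaleR)
  also have "\<dots> = (\<Sum>i\<in>UNIV. Y p $ i * \<eta> p (axis i 1))"
    by (simp add: linear_sum[OF linear_eta[OF p]] linear_scale[OF linear_eta[OF p]])
  finally have "(\<Sum>i\<in>UNIV. \<eta> p (axis i 1) * Y p $ i) = \<eta> p (Y p)" by (simp add: mult.commute)
  then show ?thesis
    unfolding ricci_sum
    by (simp add: curvature_xi[OF extend_vector(1)[OF p] Y p] extend_vector(2)[OF p] sum_subtractf
        algebra_simps)
qed

end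

section \<open>Parallel tensors and solitons\<close>

theorem theorem5p7:
  fixes M :: "'a topology"
    and A :: "('a, 'n::finite) chart set"
    and \<phi> :: "'a \<Rightarrow> real ^ 'n \<Rightarrow> real ^ 'n"
    and \<xi> :: "'a \<Rightarrow> real ^ 'n"
    and \<eta> :: "'a \<Rightarrow> real ^ 'n \<Rightarrow> real"
    and g :: "'a \<Rightarrow> real ^ 'n \<Rightarrow> real ^ 'n \<Rightarrow> real"
    and \<epsilon> \<mu> :: real
    and D :: "('a \<Rightarrow> real ^ 'n) \<Rightarrow> ('a \<Rightarrow> real ^ 'n) \<Rightarrow> 'a \<Rightarrow> real ^ 'n"
    and \<alpha> :: "('a \<Rightarrow> real ^ 'n) \<Rightarrow> ('a \<Rightarrow> real ^ 'n) \<Rightarrow> 'a \<Rightarrow> real"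
  assumes para_sasakian: "eps_para_sasakian M A \<phi> \<xi> \<eta> g \<epsilon> D"
    and alpha_def: "\<And>X Y p. \<alpha> X Y p =
      1/2 * lie_derivative_metric A \<xi> g X Y p + ricci A D X Y p + \<mu> * \<eta> p (X p) * \<eta> p (Y p)"
  shows "parallel_02 M A D \<alpha> \<longleftrightarrow>
    (\<exists>lam. (\<forall>p\<in>topspace M. lam = - \<epsilon> * \<alpha> \<xi> \<xi> p) \<and> eta_ricci_soliton M A \<eta> D g \<xi> lam \<mu>)"
proof -
  interpret para_sasakian M A \<phi> \<xi> \<eta> g \<epsilon> D
    by unfold_locales (rule para_sasakian)
  define c where "c = 1 - real CARD('n) + \<mu>"
  have alpha: "\<alpha> Y Z p = \<epsilon> * g p (\<phi> p (Y p)) (Z p) + ricci A D Y Z p + \<mu> * \<eta> p (Y p) * \<eta> p (Z p)"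
    if "smooth_vector_field A Y" "smooth_vector_field A Z" "p \<in> topspace M" for Y Z p
    unfolding alpha_def using half_lie_derivative_metric[OF that] by simp
  have alpha_xi: "\<alpha> Y \<xi> p = c * \<eta> p (Y p)" if Y: "smooth_vector_field A Y" and p: "p \<in> topspace M" for Y p
    unfolding alpha[OF Y smooth_xi p]
    by (simp add: ricci_xi[OF Y p] metric_xi[OF p] eta_phi[OF p] eta_xi[OF p] c_def algebra_simps)
  have metric_form: "lam * g p (Y p) (Z p) + \<alpha> Y Z p = 0" if "eta_ricci_soliton M A \<eta> D g \<xi> lam \<mu>"
    "smooth_vector_field A Y" "smooth_vector_field A Z" "p \<in> topspace M" for lam Y Z p
    using that unfolding eta_ricci_soliton_def alpha_def by fastforce
  show ?thesis
  proof
    assume parallel: "parallel_02 M A D \<alpha>"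
    have alpha_metric: "\<alpha> Y Z p = \<epsilon> * c * g p (Y p) (Z p)"
      if Y: "smooth_vector_field A Y" and Z: "smooth_vector_field A Z" and p: "p \<in> topspace M" for Y Z p
    proof -
      note bil = bilinear_metric[OF p]
      \<comment> \<open>For this \<open>X\<close> the field \<open>\<nabla>\<^sub>X\<xi> = \<epsilon>\<phi>\<^sup>2Z\<close> is \<open>\<epsilon>Z\<close> up to a multiple of \<open>\<xi>\<close>.\<close>
      define X where "X q = \<phi> q (Z q)" for q
      have X: "smooth_vector_field A X" unfolding X_def by (rule smooth_phi[OF Z])
      define f where "f q = - \<epsilon> * \<eta> q (Z q)" for q
      have f: "smooth_function A f"
        unfolding f_def by (intro smooth_function_mult smooth_function_const smooth_eta Z)
      have DX: "D X \<xi> q = \<epsilon> *\<^sub>R Z q + f q *\<^sub>R \<xi> q" if "q \<in> topspace M" for q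
        using D_xi[OF X that] by (simp add: X_def f_def phi_phi[OF that] scaleR_diff_right)
      have sDX: "smooth_vector_field A (D X \<xi>)" by (rule smooth_D[OF X smooth_xi])
      have eZ: "smooth_vector_field A (\<lambda>q. \<epsilon> *\<^sub>R Z q)" by (rule smooth_vector_field_cmult[OF Z])
      have fxi: "smooth_vector_field A (\<lambda>q. f q *\<^sub>R \<xi> q)" by (rule smooth_vector_field_scale[OF f smooth_xi])
      have "ricci A D Y (D X \<xi>) p = ricci A D Y (\<lambda>q. \<epsilon> *\<^sub>R Z q + f q *\<^sub>R \<xi> q) p"
        by (rule ricci_cong[OF Y sDX p DX])
      also have "\<dots> = \<epsilon> * ricci A D Y Z p + f p * ricci A D Y \<xi> p"
        by (simp add: ricci_add[OF Y eZ fxi p] ricci_scale[OF Y smooth_xi f p]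
            ricci_scale[OF Y Z smooth_function_const p])
      finally have "\<alpha> Y (D X \<xi>) p = \<epsilon> * \<alpha> Y Z p + f p * \<alpha> Y \<xi> p"
        unfolding alpha[OF Y sDX p] alpha[OF Y Z p] alpha[OF Y smooth_xi p] DX[OF p]
        by (simp add: bilinear_radd[OF bil] bilinear_rmul[OF bil] linear_add[OF linear_eta[OF p]]
            linear_scale[OF linear_eta[OF p]] algebra_simps)
      \<comment> \<open>This is the equation \<open>(\<nabla>\<^sub>X\<alpha>)(Y, \<xi>) = 0\<close>.\<close>
      moreover have "\<alpha> Y (D X \<xi>) p = c * \<epsilon> * g p (Y p) (D X \<xi> p)"
      proof -
        have gY: "smooth_function A (\<lambda>q. g q (Y q) (\<xi> q))"
          by (rule smooth_function_tensor_02[OF tensor_metric Y smooth_xi])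
        have "dir_deriv A p (X p) (\<alpha> Y \<xi>) = dir_deriv A p (X p) (\<lambda>q. c * \<epsilon> * g q (Y q) (\<xi> q))"
          by (rule dir_deriv_cong[OF p]) (simp add: alpha_xi[OF Y] eta_metric)
        also have "\<dots> = c * \<epsilon> * (g p (D X Y p) (\<xi> p) + g p (Y p) (D X \<xi> p))"
          by (simp add: dir_deriv_cmult[OF gY p] metric_compatible[OF p X Y smooth_xi])
        finally have "dir_deriv A p (X p) (\<alpha> Y \<xi>) = \<alpha> (D X Y) \<xi> p + c * \<epsilon> * g p (Y p) (D X \<xi> p)"
          by (simp add: alpha_xi[OF smooth_D[OF X Y] p] eta_metric[OF p] algebra_simps)
        moreover have "dir_deriv A p (X p) (\<alpha> Y \<xi>) - \<alpha> (D X Y) \<xi> p - \<alpha> Y (D X \<xi>) p = 0"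
          using parallel X Y smooth_xi p by (simp add: parallel_02_def)
        ultimately show ?thesis by simp
      qed
      ultimately have "\<epsilon> * \<alpha> Y Z p = c * g p (Y p) (Z p)"
        by (simp add: DX[OF p] alpha_xi[OF Y p] bilinear_radd[OF bil] bilinear_rmul[OF bil]
            metric_xi[OF p] algebra_simps)
      then have "\<epsilon> * (\<epsilon> * \<alpha> Y Z p) = \<epsilon> * (c * g p (Y p) (Z p))" by simp
      then show ?thesis by simp
    qed
    have "eta_ricci_soliton M A \<eta> D g \<xi> (- \<epsilon> * c) \<mu>"
      unfolding eta_ricci_soliton_def
    proof (intro allI impI ballI)
      fix Y Z p assume "smooth_vector_field A Y" "smooth_vector_field A Z" "p \<in> topspace M"
      from alpha_metric[OF this]
      show "1/2 * lie_derivative_metric A \<xi> g Y Z p + ricci A D Y Z p + - \<epsilon> * c * g p (Y p) (Z p) +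
          \<mu> * \<eta> p (Y p) * \<eta> p (Z p) = 0"
        unfolding alpha_def by simp
    qed
    moreover have "\<forall>p\<in>topspace M. - \<epsilon> * c = - \<epsilon> * \<alpha> \<xi> \<xi> p"
      by (simp add: alpha_xi[OF smooth_xi] eta_xi)
    ultimately show "\<exists>lam. (\<forall>p\<in>topspace M. lam = - \<epsilon> * \<alpha> \<xi> \<xi> p) \<and> eta_ricci_soliton M A \<eta> D g \<xi> lam \<mu>"
      by blast
  next
    assume "\<exists>lam. (\<forall>p\<in>topspace M. lam = - \<epsilon> * \<alpha> \<xi> \<xi> p) \<and> eta_ricci_soliton M A \<eta> D g \<xi> lam \<mu>"
    then obtain lam where "eta_ricci_soliton M A \<eta> D g \<xi> lam \<mu>" by blast
    then have alpha_metric: "\<alpha> Y Z p = - lam * g p (Y p) (Z p)"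
      if "smooth_vector_field A Y" "smooth_vector_field A Z" "p \<in> topspace M" for Y Z p
      using metric_form[OF _ that] by fastforce
    show "parallel_02 M A D \<alpha>"
      unfolding parallel_02_def
    proof (intro allI impI ballI)
      fix X Y Z p assume X: "smooth_vector_field A X" and Y: "smooth_vector_field A Y"
        and Z: "smooth_vector_field A Z" and p: "p \<in> topspace M"
      have gYZ: "smooth_function A (\<lambda>q. g q (Y q) (Z q))"
        by (rule smooth_function_tensor_02[OF tensor_metric Y Z])
      have "dir_deriv A p (X p) (\<alpha> Y Z) = dir_deriv A p (X p) (\<lambda>q. - lam * g q (Y q) (Z q))"
        by (rule dir_deriv_cong[OF p alpha_metric[OF Y Z]])
      also have "\<dots> = - lam * (g p (D X Y p) (Z p) + g p (Y p) (D X Z p))"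
        by (simp only: dir_deriv_cmult[OF gYZ p] metric_compatible[OF p X Y Z])
      finally show "dir_deriv A p (X p) (\<alpha> Y Z) - \<alpha> (D X Y) Z p - \<alpha> Y (D X Z) p = 0"
        unfolding alpha_metric[OF smooth_D[OF X Y] Z p] alpha_metric[OF Y smooth_D[OF X Z] p]
        by (simp add: algebra_simps)
    qed
  qed
qed

end
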